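(* If $(M,d)$ is a Polish metric space (complete and separable), then the space $(\mathrm{TP}(M),\|\cdot\|_{\mathrm{TC}})$ is dense in $(\mathcal{M},\|\cdot\|_{\mathrm{KR}})$. Hence $\mathrm{TC}(M)$ can be regarded as the completion of $(\mathcal{M},\|\cdot\|_{\mathrm{KR}})$.
   Context: $\mathrm{TP}(M)$ is the real vector space of all finitely supported functions $f:M\to\mathbb{R}$ with $\sum_{v\in M}f(v)=0$. For $u\in M$, $\mathbf{1}_u$ is the indicator function of $\{u\}$. The transportation cost norm $\|f\|_{\mathrm{TC}}$ of $f\in\mathrm{TP}(M)$ is the minimum of $\sum_{i=1}^n a_i d(x_i,y_i)$ over all representations $f=\sum_{i=1}^n a_i(\mathbf{1}_{x_i}-\mathbf{1}_{y_i})$ with $a_i\ge0$, $x_i,y_i\in M$. $\mathrm{TC}(M)$ is the completion of $(\mathrm{TP}(M),\|\cdot\|_{\mathrm{TC}})$. $\mathcal{M}$ is the real vector space of all differences $\mu-\nu$, where $\mu,\nu$ are finite positive Borel measures on $M$ with the same total mass and such that $\int_M d(x,x_0)\,d\mu(x)<\infty$ and $\int_M d(x,x_0)\,d\nu(x)<\infty$ for some (hence all) $x_0\in M$. A coupling of $(\mu,\nu)$ is a Borel measure $\pi$ on $M\times M$ with $\mu(A)=\pi(A\times M)$ and $\nu(A)=\pi(M\times A)$ for all Borel $A\subset M$; $\Pi(\mu,\nu)$ is the set of couplings. The Kantorovich–Rubinstein norm on $\mathcal{M}$ is $$\|\mu-\nu\|_{\mathrm{KR}}=\inf_{\pi\in\Pi(\mu,\nu)}\iint_{M\times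 M}d(x,y)\,d\pi(x,y).$$ An element $f\in\mathrm{TP}(M)$ is identified with the finitely supported signed measure $\sum_{v}f(v)\delta_v\in\mathcal{M}$ ($\delta_v$ the unit atom at $v$); under this identification the norms $\|\cdot\|_{\mathrm{TC}}$ and $\|\cdot\|_{\mathrm{KR}}$ agree on $\mathrm{TP}(M)$. (It is a theorem of Kantorovich and Rubinstein that $\|\cdot\|_{\mathrm{KR}}$ is a well-defined norm on $\mathcal{M}$ whose dual is the space of Lipschitz functions on $M$ vanishing at a base point, normed by the Lipschitz constant.) *)

theory Defs
  imports "HOL-Probability.Probability"
begin

section \<open>Transportation problems and the transportation cost norm\<close>

definition TP :: "('a \<Rightarrow> real) set" where
  "TP = {f. finite {v. f v \<noteq> 0} \<and> (\<Sum>v | f v \<noteq> 0. f v) = 0}"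

definition tc_representation ::
  "('a \<Rightarrow> real) \<Rightarrow> nat \<Rightarrow> (nat \<Rightarrow> real) \<Rightarrow> (nat \<Rightarrow> 'a) \<Rightarrow> (nat \<Rightarrow> 'a) \<Rightarrow> bool" where
  "tc_representation f n a x y \<longleftrightarrow>
     (\<forall>i<n. 0 \<le> a i) \<and>
     f = (\<lambda>v. \<Sum>i<n. a i * (indicator {x i} v - indicator {y i} v))"

(* The infimum is attained, so this is the minimal cost of a representation. *)
definition tc_norm :: "('a::metric_space \<Rightarrow> real) \<Rightarrow> real" where
  "tc_norm f = Inf {\<Sum>i<n. a i * dist (x i) (y i) | n a x y. tc_representation f n a x y}"


section \<open>Differences of measures and the Kantorovich-Rubinstein norm\<close>

definition finite_first_moment :: "'a::metric_space measure \<Rightarrow> bool" where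
  "finite_first_moment \<mu> \<longleftrightarrow> (\<exists>x0. (\<integral>\<^sup>+x. ennreal (dist x x0) \<partial>\<mu>) < \<infinity>)"

definition kr_pair :: "'a::metric_space measure \<Rightarrow> 'a measure \<Rightarrow> bool" where
  "kr_pair \<mu> \<nu> \<longleftrightarrow>
     sets \<mu> = sets borel \<and> sets \<nu> = sets borel \<and>
     finite_measure \<mu> \<and> finite_measure \<nu> \<and>
     emeasure \<mu> UNIV = emeasure \<nu> UNIV \<and>
     finite_first_moment \<mu> \<and> finite_first_moment \<nu>"

(* Signed measures are represented by their values on sets. Since measure is 0
   on non-measurable sets, these functions vanish outside the Borel sets, so
   equality of functions is equality of signed measures. *)
definition measure_diff :: "'a measure \<Rightarrow> 'a measure \<Rightarrow> 'a set \<Rightarrow> real" where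
  "measure_diff \<mu> \<nu> = (\<lambda>A. measure \<mu> A - measure \<nu> A)"

definition KRM :: "('a::metric_space set \<Rightarrow> real) set" where
  "KRM = {measure_diff \<mu> \<nu> | \<mu> \<nu>. kr_pair \<mu> \<nu>}"

definition couplings ::
  "'a::metric_space measure \<Rightarrow> 'a measure \<Rightarrow> ('a \<times> 'a) measure set" where
  "couplings \<mu> \<nu> =
     {\<pi>. sets \<pi> = sets borel \<and>
         (\<forall>A\<in>sets borel. emeasure \<mu> A = emeasure \<pi> (A \<times> UNIV) \<and>
                         emeasure \<nu> A = emeasure \<pi> (UNIV \<times> A))}"

definition kr_cost :: "'a::metric_space measure \<Rightarrow> 'a measure \<Rightarrow> real" where
  "kr_cost \<mu> \<nu> =
     enn2real (INF \<pi>\<in>couplings \<mu> \<nu>. \<integral>\<^sup>+p. ennreal (dist (fst p) (snd p)) \<partial>\<pi>)"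

(* The cost depends only on the difference of the two measures (Kantorovich and
   Rubinstein), so the value below is the common cost of all pairs representing m. *)
definition kr_norm :: "('a::metric_space set \<Rightarrow> real) \<Rightarrow> real" where
  "kr_norm m = (THE c. \<forall>\<mu> \<nu>. kr_pair \<mu> \<nu> \<and> m = measure_diff \<mu> \<nu> \<longrightarrow> c = kr_cost \<mu> \<nu>)"

definition tp_measure :: "('a::metric_space \<Rightarrow> real) \<Rightarrow> 'a set \<Rightarrow> real" where
  "tp_measure f = (\<lambda>A. \<Sum>v | f v \<noteq> 0. f v * measure (return borel v) A)"


section \<open>Completions\<close>

(* The closed subspace X of a Banach space, together with \<iota>, is a completion of
   the space V of real functions (with pointwise operations) normed by N.
   Injectivity is required because N is not assumed to be a norm beforehand:
   with it, the isometry condition makes N a norm on V. *)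
definition is_completion ::
  "('c \<Rightarrow> real) set \<Rightarrow> (('c \<Rightarrow> real) \<Rightarrow> real) \<Rightarrow> (('c \<Rightarrow> real) \<Rightarrow> 'b::banach) \<Rightarrow> 'b set \<Rightarrow> bool"
  where
  "is_completion V N \<iota> X \<longleftrightarrow>
     (\<forall>f\<in>V. \<forall>g\<in>V. \<forall>a b.
        (\<lambda>t. a * f t + b * g t) \<in> V \<and>
        \<iota> (\<lambda>t. a * f t + b * g t) = a *\<^sub>R \<iota> f + b *\<^sub>R \<iota> g) \<and>
     (\<forall>f\<in>V. norm (\<iota> f) = N f) \<and>
     inj_on \<iota> V \<and>
     closure (\<iota> ` V) = X"

end

(*
Let two pairs of measures have the same difference, and let \<pi> couple the second pair. A finitely
valued Borel map T with small \<integral> d(x, T x) turns \<pi> into a finite matrix whose row sums minus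
column sums are prescribed. Mass that merely passes through a vertex can be rerouted directly from its
sources to its destinations, at no extra cost by the triangle inequality, until the row and column sums
are the ones of the first pair pushed forward by T. Spreading every matrix entry over the
corresponding rectangle of fibres as a product measure lifts the matrix to a coupling of the first
pair. Hence the transport cost depends only on the difference. Once this is known, subadditivity and
homogeneity come from adding and scaling couplings, definiteness from Markov's inequality on
neighbourhoods of closed sets, the equality with the transportation cost norm from the fact that a
coupling of finitely supported measures is a representation, and density from the
coupling (id, T). An isometric linear map on a dense subspace extends to the whole space.
*)
theory Submission
  imports Defs
begin

section \<open>Rerouting finite transport plans\<close>

text \<open>\<open>kr_norm\<close> is a definite description over all representing pairs, so nothing
  is known about it before different pairs have been compared. The obstacle is common mass: adding
  the same \<open>\<rho>\<close> to \<open>\<mu>\<close> and to \<open>\<nu>\<close> keeps the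
  difference, but a coupling of the larger pair may send mass of \<open>\<mu>\<close> into
  \<open>\<rho>\<close> and mass of \<open>\<rho>\<close> on to \<open>\<nu>\<close>. Shortcutting
  such detours for general measures would involve conditional distributions; on finitely many
  vertices it is done one vertex at a time by an explicit formula. Two features make the passage to
  finitely many vertices harmless in the limit. The same \<open>T\<close> acts on all four measures,
  so equal differences stay equal. And the bound on the error made by replacing
  \<open>dist x y\<close> with \<open>dist (T x) (T y)\<close> depends only on the marginals, so it
  also holds for a coupling that is constructed only after \<open>T\<close> has been chosen.\<close>

definition transport_plan ::
  "'a set \<Rightarrow> ('a \<Rightarrow> 'a \<Rightarrow> real) \<Rightarrow> ('a \<Rightarrow> real) \<Rightarrow> ('a \<Rightarrow> real) \<Rightarrow> bool" where
  "transport_plan V p a b \<longleftrightarrow>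
     (\<forall>x\<in>V. \<forall>y\<in>V. 0 \<le> p x y) \<and>
     (\<forall>x\<in>V. (\<Sum>y\<in>V. p x y) = a x) \<and>
     (\<forall>y\<in>V. (\<Sum>x\<in>V. p x y) = b y)"

definition plan_cost :: "'a::metric_space set \<Rightarrow> ('a \<Rightarrow> 'a \<Rightarrow> real) \<Rightarrow> real" where
  "plan_cost V p = (\<Sum>x\<in>V. \<Sum>y\<in>V. p x y * dist x y)"

text \<open>Diagonal entries carry distance 0, so a vertex can gain or lose the same mass in its row
  and its column at no cost. Negative \<open>l\<close> is allowed, as long as the diagonal stays
  nonnegative: this is how loops are deleted later.\<close>

lemma transport_plan_add_diagonal:
  assumes p: "transport_plan V p a b" and V: "finite V"
    and ge: "\<And>x. x \<in> V \<Longrightarrow> 0 \<le> p x x + l x"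
  shows "transport_plan V (\<lambda>x y. p x y + (if x = y then l x else 0)) (\<lambda>x. a x + l x) (\<lambda>x. b x + l x)"
    and "plan_cost V (\<lambda>x y. p x y + (if x = y then l x else 0)) = plan_cost V p"
proof -
  show "transport_plan V (\<lambda>x y. p x y + (if x = y then l x else 0)) (\<lambda>x. a x + l x) (\<lambda>x. b x + l x)"
    using p ge V by (auto simp: transport_plan_def sum.distrib)
  have "(if x = y then l x else 0) * dist x y = 0" for x y :: 'a
    by simp
  then show "plan_cost V (\<lambda>x y. p x y + (if x = y then l x else 0)) = plan_cost V p"
    by (simp only: plan_cost_def distrib_right add_0_right)
qed

text \<open>
  The mass \<open>c\<close> passing through \<open>v\<close> is sent from its sources directly to its destinations,
  proportionally on both sides; the triangle inequality bounds the new cost.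
\<close>
lemma transport_plan_bypass_no_loop:
  fixes p :: "'a::metric_space \<Rightarrow> 'a \<Rightarrow> real"
  assumes p: "transport_plan V p (a(v := a v + c)) (b(v := b v + c))"
    and V: "finite V" "v \<in> V" and ab: "0 \<le> a v" "0 \<le> b v" and c: "0 < c" and loop: "p v v = 0"
  shows "\<exists>q. transport_plan V q a b \<and> plan_cost V q \<le> plan_cost V p"
proof -
  define \<alpha> where "\<alpha> x = p x v / (b v + c)" for x
  define \<beta> where "\<beta> y = p v y / (a v + c)" for y
  \<comment> \<open>With \<open>d\<close> the indicator of \<open>v\<close>, the bracket equals
    \<open>(\<alpha> - d) x * (\<beta> - d) y - d x * d y\<close>. The first product has row and
    column sums 0, because \<open>\<alpha>\<close>, \<open>\<beta>\<close> and \<open>d\<close> each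
    have total 1; the second term removes exactly \<open>c\<close> from row \<open>v\<close> and
    from column \<open>v\<close>.\<close>
  define q where "q x y = p x y + c * (\<alpha> x * \<beta> y - \<alpha> x * of_bool (y = v) - of_bool (x = v) * \<beta> y)" for x y
  have nn: "0 \<le> p x y" if "x \<in> V" "y \<in> V" for x y
    using p that by (auto simp: transport_plan_def)
  have rows: "(\<Sum>y\<in>V. p x y) = (a(v := a v + c)) x" if "x \<in> V" for x
    using p that unfolding transport_plan_def by blast
  have cols: "(\<Sum>x\<in>V. p x y) = (b(v := b v + c)) y" if "y \<in> V" for y
    using p that unfolding transport_plan_def by blast
  have \<alpha>nn: "0 \<le> \<alpha> x" if "x \<in> V" for x
    using nn[OF that V(2)] ab c by (simp add: \<alpha>_def)
  have \<beta>nn: "0 \<le> \<beta> x" if "x \<in> V" for x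
    using nn[OF V(2) that] ab c by (simp add: \<beta>_def)
  have \<alpha>1: "(\<Sum>x\<in>V. \<alpha> x) = 1"
    using cols[OF V(2)] ab c by (simp add: \<alpha>_def flip: sum_divide_distrib)
  have \<beta>1: "(\<Sum>x\<in>V. \<beta> x) = 1"
    using rows[OF V(2)] ab c by (simp add: \<beta>_def flip: sum_divide_distrib)
  have \<alpha>le: "c * \<alpha> x \<le> p x v" if "x \<in> V" for x
    using nn[OF that V(2)] ab c by (simp add: \<alpha>_def field_simps)
  have \<beta>le: "c * \<beta> x \<le> p v x" if "x \<in> V" for x
    using nn[OF V(2) that] ab c by (simp add: \<beta>_def field_simps)
  \<comment> \<open>This is where the absence of a loop matters: the entry of \<open>q\<close> at
    \<open>(v, v)\<close> is now 0. With a loop it can be negative; for \<open>a v = b v = 0\<close>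
    it would be \<open>p v v * (p v v / c - 1)\<close>.\<close>
  have \<alpha>v: "\<alpha> v = 0" and \<beta>v: "\<beta> v = 0"
    using loop by (simp_all add: \<alpha>_def \<beta>_def)
  have ind: "(\<Sum>y\<in>V. of_bool (y = v) * f y) = f v" for f :: "'a \<Rightarrow> real"
    using V by (simp add: of_bool_def if_distrib[of "\<lambda>t. t * _"] cong: if_cong)
  have ind': "(\<Sum>y\<in>V. of_bool (y = v)) = (1::real)"
    using ind[of "\<lambda>_. 1"] by simp
  have qnn: "0 \<le> q x y" if "x \<in> V" "y \<in> V" for x y
  proof -
    have "0 \<le> c * (\<alpha> x * \<beta> y)"
      using c \<alpha>nn \<beta>nn that by simp
    then show ?thesis
      using nn[OF that] \<alpha>le[OF that(1)] \<beta>le[OF that(2)] \<alpha>v \<beta>v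
      by (cases "x = v"; cases "y = v") (auto simp: q_def right_diff_distrib loop)
  qed
  have qrow: "(\<Sum>y\<in>V. q x y) = a x" if "x \<in> V" for x
  proof -
    have "(\<Sum>y\<in>V. q x y) = (\<Sum>y\<in>V. p x y)
        + c * (\<alpha> x * (\<Sum>y\<in>V. \<beta> y) - \<alpha> x * (\<Sum>y\<in>V. of_bool (y = v)) - of_bool (x = v) * (\<Sum>y\<in>V. \<beta> y))"
      unfolding q_def by (simp add: sum.distrib sum_subtractf flip: sum_distrib_left)
    then show ?thesis
      using rows[OF that] by (auto simp: \<beta>1 ind')
  qed
  have qcol: "(\<Sum>x\<in>V. q x y) = b y" if "y \<in> V" for y
  proof -
    have "(\<Sum>x\<in>V. q x y) = (\<Sum>x\<in>V. p x y)
        + c * ((\<Sum>x\<in>V. \<alpha> x) * \<beta> y - (\<Sum>x\<in>V. \<alpha> x) * of_bool (y = v) - (\<Sum>x\<in>V. of_bool (x = v)) * \<beta> y)"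
      unfolding q_def by (simp add: sum.distrib sum_subtractf flip: sum_distrib_left sum_distrib_right)
    then show ?thesis
      using cols[OF that] by (auto simp: \<alpha>1 ind')
  qed
  have "plan_cost V q = plan_cost V p + c * ((\<Sum>x\<in>V. \<Sum>y\<in>V. \<alpha> x * \<beta> y * dist x y)
      - (\<Sum>x\<in>V. \<alpha> x * (\<Sum>y\<in>V. of_bool (y = v) * dist x y))
      - (\<Sum>x\<in>V. of_bool (x = v) * (\<Sum>y\<in>V. \<beta> y * dist x y)))"
    unfolding plan_cost_def q_def
    by (simp add: sum.distrib sum_subtractf sum_distrib_left algebra_simps)
  also have "\<dots> = plan_cost V p + c * ((\<Sum>x\<in>V. \<Sum>y\<in>V. \<alpha> x * \<beta> y * dist x y)
      - (\<Sum>x\<in>V. \<alpha> x * dist x v) - (\<Sum>y\<in>V. \<beta> y * dist v y))"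
    by (simp only: ind)
  also have "(\<Sum>x\<in>V. \<Sum>y\<in>V. \<alpha> x * \<beta> y * dist x y)
      \<le> (\<Sum>x\<in>V. \<Sum>y\<in>V. \<alpha> x * \<beta> y * (dist x v + dist v y))"
    by (intro sum_mono mult_left_mono dist_triangle mult_nonneg_nonneg \<alpha>nn \<beta>nn)
  also have "\<dots> = (\<Sum>x\<in>V. \<alpha> x * dist x v) * (\<Sum>y\<in>V. \<beta> y) + (\<Sum>x\<in>V. \<alpha> x) * (\<Sum>y\<in>V. \<beta> y * dist v y)"
    unfolding sum_product sum.distrib[symmetric] by (intro sum.cong refl) (simp add: algebra_simps)
  finally have "plan_cost V q \<le> plan_cost V p"
    using c by (simp add: \<alpha>1 \<beta>1)
  moreover have "transport_plan V q a b"
    using qnn qrow qcol by (auto simp: transport_plan_def)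
  ultimately show ?thesis
    by blast
qed

text \<open>Reduction to the loop-free case. The part \<open>m\<close> of the surplus that sits on
  the diagonal is deleted for free. Either this is the whole surplus \<open>c\<close>, or the loop
  is used up and \<open>c - m\<close> is still to be rerouted.\<close>

lemma transport_plan_bypass:
  fixes p :: "'a::metric_space \<Rightarrow> 'a \<Rightarrow> real"
  assumes p: "transport_plan V p (a(v := a v + c)) (b(v := b v + c))"
    and V: "finite V" "v \<in> V" and ab: "0 \<le> a v" "0 \<le> b v" and c: "0 \<le> c"
  shows "\<exists>q. transport_plan V q a b \<and> plan_cost V q \<le> plan_cost V p"
proof -
  define m where "m = min c (p v v)"
  define l where "l x = (if x = v then - m else 0)" for x
  define p' where "p' x y = p x y + (if x = y then l x else 0)" for x y
  have nn: "0 \<le> p x y" if "x \<in> V" "y \<in> V" for x y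
    using p that by (auto simp: transport_plan_def)
  have ge: "0 \<le> p x x + l x" if "x \<in> V" for x
    using nn[OF that that] by (auto simp: l_def m_def)
  have eq: "(\<lambda>x. (a(v := a v + c)) x + l x) = a(v := a v + (c - m))"
    "(\<lambda>x. (b(v := b v + c)) x + l x) = b(v := b v + (c - m))"
    by (auto simp: l_def)
  note p' = transport_plan_add_diagonal[OF p V(1) ge, folded p'_def, unfolded eq]
  show ?thesis
  proof (cases "c \<le> p v v")
    case True
    then have "a(v := a v + (c - m)) = a" "b(v := b v + (c - m)) = b"
      by (auto simp: m_def)
    then show ?thesis
      using p' by auto
  next
    case False
    then have "0 < c - m" "p' v v = 0"
      by (auto simp: m_def p'_def l_def)
    from transport_plan_bypass_no_loop[OF p'(1) V ab this] show ?thesis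
      by (simp add: p'(2))
  qed
qed

text \<open>Bypassing one vertex changes the row and column sums at that vertex only, so the
  surpluses can be removed one after the other.\<close>

lemma transport_plan_bypass_set:
  fixes p :: "'a::metric_space \<Rightarrow> 'a \<Rightarrow> real"
  assumes "finite S" "S \<subseteq> V" "finite V"
    and "\<And>x. x \<in> V \<Longrightarrow> 0 \<le> a x" "\<And>x. x \<in> V \<Longrightarrow> 0 \<le> b x" "\<And>x. x \<in> V \<Longrightarrow> 0 \<le> l x"
    and "transport_plan V p (\<lambda>x. a x + (if x \<in> S then l x else 0)) (\<lambda>x. b x + (if x \<in> S then l x else 0))"
  shows "\<exists>q. transport_plan V q a b \<and> plan_cost V q \<le> plan_cost V p"
  using assms
proof (induction S arbitrary: p rule: finite_induct)
  case empty
  then show ?case by auto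
next
  case (insert v S)
  let ?a = "\<lambda>x. a x + (if x \<in> S then l x else 0)" and ?b = "\<lambda>x. b x + (if x \<in> S then l x else 0)"
  have "?a(v := ?a v + l v) = (\<lambda>x. a x + (if x \<in> insert v S then l x else 0))"
    "?b(v := ?b v + l v) = (\<lambda>x. b x + (if x \<in> insert v S then l x else 0))"
    using insert.hyps by auto
  with insert.prems have "transport_plan V p (?a(v := ?a v + l v)) (?b(v := ?b v + l v))"
    by simp
  then obtain q where q: "transport_plan V q ?a ?b" "plan_cost V q \<le> plan_cost V p"
    using transport_plan_bypass[of V p ?a v "l v" ?b] insert.prems insert.hyps by auto
  with insert.IH[of q] insert.prems show ?case
    by fastforce
qed

text \<open>Equal differences mean that \<open>a' - a\<close> and \<open>b' - b\<close> are the same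
  function. Its negative part \<open>k\<close> is put on the diagonal for free, after which the sums
  dominate \<open>a\<close> and \<open>b\<close>. The remaining excess \<open>l\<close>, its
  positive part, is common to rows and columns and is bypassed.\<close>

lemma transport_plan_of_same_difference:
  fixes p :: "'a::metric_space \<Rightarrow> 'a \<Rightarrow> real"
  assumes p: "transport_plan V p a' b'" and V: "finite V"
    and ab: "\<And>x. x \<in> V \<Longrightarrow> 0 \<le> a x" "\<And>x. x \<in> V \<Longrightarrow> 0 \<le> b x"
    and diff: "\<And>x. x \<in> V \<Longrightarrow> a' x - b' x = a x - b x"
  shows "\<exists>q. transport_plan V q a b \<and> plan_cost V q \<le> plan_cost V p"
proof -
  define k where "k x = max 0 (a x - a' x)" for x
  define p' where "p' x y = p x y + (if x = y then k x else 0)" for x y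
  have "0 \<le> p x x + k x" if "x \<in> V" for x
    using p that by (auto simp: transport_plan_def k_def)
  note p' = transport_plan_add_diagonal[OF p V this, folded p'_def]
  define l where "l x = a' x + k x - a x" for x
  have l: "0 \<le> l x" for x
    by (auto simp: l_def k_def)
  have "transport_plan V p' (\<lambda>x. a x + (if x \<in> V then l x else 0)) (\<lambda>x. b x + (if x \<in> V then l x else 0))"
    using p'(1) diff by (fastforce simp: transport_plan_def l_def)
  from transport_plan_bypass_set[OF V order_refl V ab l this] show ?thesis
    by (simp add: p'(2))
qed

section \<open>Sums of measures, couplings and discretisation\<close>

definition add_measure :: "'a measure \<Rightarrow> 'a measure \<Rightarrow> 'a measure" where
  "add_measure M N = measure_of (space M) (sets M) (\<lambda>A. emeasure M A + emeasure N A)"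

lemma sets_add_measure [simp, measurable_cong]: "sets (add_measure M N) = sets M"
  and space_add_measure [simp]: "space (add_measure M N) = space M"
  by (simp_all add: add_measure_def)

lemma emeasure_add_measure [simp]:
  assumes "sets N = sets M"
  shows "emeasure (add_measure M N) A = emeasure M A + emeasure N A"
proof (cases "A \<in> sets M")
  case True
  have "countably_additive (sets M) (\<lambda>A. emeasure M A + emeasure N A)"
    by (rule countably_additiveI) (simp add: suminf_add[symmetric] suminf_emeasure assms)
  with True show ?thesis
    unfolding add_measure_def
    by (subst emeasure_measure_of_sigma) (auto simp: positive_def sets.sigma_algebra_axioms)
next
  case False
  then show ?thesis
    by (simp add: emeasure_notin_sets assms)
qed

lemma nn_integral_add_measure:
  assumes N: "sets N = sets M" and f: "f \<in> borel_measurable M"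
  shows "(\<integral>\<^sup>+x. f x \<partial>add_measure M N) = (\<integral>\<^sup>+x. f x \<partial>M) + (\<integral>\<^sup>+x. f x \<partial>N)"
  using f
proof induction
  case (cong f g)
  then show ?case
    using sets_eq_imp_space_eq[OF N] by (simp cong: nn_integral_cong_simp)
next
  case (set A)
  then show ?case by (simp add: N)
next
  case (mult u c)
  then have "u \<in> borel_measurable N" "u \<in> borel_measurable (add_measure M N)"
    by (simp_all add: measurable_cong_sets[OF N refl] measurable_cong_sets[OF sets_add_measure refl])
  with mult show ?case
    by (simp add: nn_integral_cmult distrib_left)
next
  case (add u v)
  then show ?case
    by (simp add: nn_integral_add measurable_cong_sets[OF N refl] measurable_cong_sets[OF sets_add_measure refl] ac_simps)
next
  case (seq U)
  have "(\<integral>\<^sup>+x. (SUP i. U i) x \<partial>K) = (SUP i. \<integral>\<^sup>+x. U i x \<partial>K)" if "sets K = sets M" for K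
    using seq that by (simp add: nn_integral_monotone_convergence_SUP measurable_cong_sets[OF that refl] image_comp SUP_apply)
  then show ?case
    using seq by (simp add: N ennreal_SUP_add incseq_nn_integral)
qed

lemma measure_add_measure:
  assumes "finite_measure M" "finite_measure N" "sets N = sets M"
  shows "measure (add_measure M N) A = measure M A + measure N A"
  unfolding measure_def emeasure_add_measure[OF assms(3)]
  by (intro enn2real_plus) (simp_all add: assms finite_measure.emeasure_finite flip: less_top)

lemma finite_measure_add_measure:
  assumes "finite_measure M" "finite_measure N" "sets N = sets M"
  shows "finite_measure (add_measure M N)"
  using assms by (intro finite_measureI) (auto simp: finite_measure.emeasure_finite)

lemma finite_measure_scale_measure:
  assumes "finite_measure M" "r \<noteq> \<top>"
  shows "finite_measure (scale_measure r M)"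
  using assms by (intro finite_measureI)
    (auto simp: finite_measure.emeasure_finite space_scale_measure ennreal_mult_eq_top_iff)

section \<open>Couplings and their marginals\<close>

lemma borel_measurable_fst_snd [measurable]:
  "fst \<in> borel_measurable (borel :: ('a::topological_space \<times> 'b::topological_space) measure)"
  "snd \<in> borel_measurable (borel :: ('a::topological_space \<times> 'b::topological_space) measure)"
  by (intro borel_measurable_continuous_onI continuous_intros)+

text \<open>In the form of pushforwards the marginal conditions compose with
  \<open>distr_distr\<close> and \<open>nn_integral_distr\<close>; the couplings that arise as
  images of a measure are checked this way.\<close>

lemma couplings_iff:
  fixes \<mu> \<nu> :: "'a::metric_space measure"
  assumes "sets \<mu> = sets borel" "sets \<nu> = sets borel"
  shows "\<pi> \<in> couplings \<mu> \<nu> \<longleftrightarrow> sets \<pi> = sets borel \<and> distr \<pi> borel fst = \<mu> \<and> distr \<pi> borel snd = \<nu>"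
proof (cases "sets \<pi> = sets borel")
  case True
  have [simp]: "space \<pi> = UNIV"
    using sets_eq_imp_space_eq[OF True] by simp
  have [measurable]: "fst \<in> measurable \<pi> borel" "snd \<in> measurable \<pi> borel"
    by (simp_all add: measurable_cong_sets[OF True refl])
  have "emeasure (distr \<pi> borel fst) A = emeasure \<pi> (A \<times> UNIV)"
    "emeasure (distr \<pi> borel snd) A = emeasure \<pi> (UNIV \<times> A)" if "A \<in> sets borel" for A
    using that by (auto simp: emeasure_distr vimage_fst vimage_snd)
  then show ?thesis
    using True assms by (auto simp: couplings_def intro!: measure_eqI)
qed (simp add: couplings_def)

abbreviation coupling_cost :: "('a::metric_space \<times> 'a) measure \<Rightarrow> ennreal" where
  "coupling_cost \<pi> \<equiv> \<integral>\<^sup>+z. ennreal (dist (fst z) (snd z)) \<partial>\<pi>"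

lemma nn_integral_coupling:
  fixes \<mu> \<nu> :: "'a::metric_space measure"
  assumes "sets \<mu> = sets borel" "sets \<nu> = sets borel" "\<pi> \<in> couplings \<mu> \<nu>"
    and f: "f \<in> borel_measurable borel"
  shows "(\<integral>\<^sup>+z. f (fst z) \<partial>\<pi>) = (\<integral>\<^sup>+x. f x \<partial>\<mu>)"
    and "(\<integral>\<^sup>+z. f (snd z) \<partial>\<pi>) = (\<integral>\<^sup>+x. f x \<partial>\<nu>)"
proof -
  have s: "sets \<pi> = sets borel" and d: "distr \<pi> borel fst = \<mu>" "distr \<pi> borel snd = \<nu>"
    using assms couplings_iff by blast+
  have "fst \<in> measurable \<pi> borel" "snd \<in> measurable \<pi> borel"
    by (simp_all add: measurable_cong_sets[OF s refl])
  then show "(\<integral>\<^sup>+z. f (fst z) \<partial>\<pi>) = (\<integral>\<^sup>+x. f x \<partial>\<mu>)" "(\<integral>\<^sup>+z. f (snd z) \<partial>\<pi>) = (\<integral>\<^sup>+x. f x \<partial>\<nu>)"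
    using f by (simp_all flip: d add: nn_integral_distr)
qed

lemma finite_measure_coupling:
  fixes \<mu> \<nu> :: "'a::metric_space measure"
  assumes "finite_measure \<mu>" "sets \<mu> = sets borel" "\<pi> \<in> couplings \<mu> \<nu>"
  shows "finite_measure \<pi>"
proof
  have s: "sets \<pi> = sets borel" and "emeasure \<pi> (UNIV \<times> UNIV) = emeasure \<mu> UNIV"
    using assms by (auto simp: couplings_def)
  moreover have "emeasure \<mu> UNIV \<noteq> \<top>"
    by (rule finite_measure.emeasure_finite[OF assms(1)])
  ultimately show "emeasure \<pi> (space \<pi>) \<noteq> \<infinity>"
    using sets_eq_imp_space_eq[OF s] by simp
qed

section \<open>First moments and approximation of the identity by finitely valued maps\<close>

text \<open>The total mass is finite, so a change of base point adds only a finite constant. Later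
  proofs may therefore take any base point, such as \<open>undefined\<close>.\<close>

lemma first_moment_finite:
  fixes \<mu> :: "'a::{metric_space, second_countable_topology} measure"
  assumes "sets \<mu> = sets borel" "finite_measure \<mu>" "finite_first_moment \<mu>"
  shows "(\<integral>\<^sup>+x. ennreal (dist x z) \<partial>\<mu>) < \<infinity>"
proof -
  obtain x0 where x0: "(\<integral>\<^sup>+x. ennreal (dist x x0) \<partial>\<mu>) < \<infinity>"
    using assms(3) by (auto simp: finite_first_moment_def)
  note [measurable_cong] = assms(1)
  have "(\<integral>\<^sup>+x. ennreal (dist x z) \<partial>\<mu>) \<le> (\<integral>\<^sup>+x. ennreal (dist x x0) + ennreal (dist x0 z) \<partial>\<mu>)"
    by (intro nn_integral_mono) (simp add: dist_triangle flip: ennreal_plus)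
  also have "\<dots> = (\<integral>\<^sup>+x. ennreal (dist x x0) \<partial>\<mu>) + ennreal (dist x0 z) * emeasure \<mu> (space \<mu>)"
    by (subst nn_integral_add) measurable
  also have "\<dots> < \<infinity>"
    using x0 finite_measure.emeasure_finite[OF assms(2)]
    by (simp add: ennreal_mult_less_top less_top)
  finally show ?thesis .
qed

text \<open>The quantifier order is essential: one sequence must serve all measures
  \<open>\<rho>\<close>, since the same map will be applied to every measure of a comparison. This
  is possible because \<open>T n\<close> converges to the identity pointwise, with a bound that does
  not involve \<open>\<rho>\<close>.\<close>

lemma ex_simple_retraction_sequence:
  "\<exists>T :: nat \<Rightarrow> 'a::{metric_space, second_countable_topology} \<Rightarrow> 'a.
     (\<forall>n. T n \<in> borel_measurable borel \<and> finite (range (T n))) \<and>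
     (\<forall>\<rho>. sets \<rho> = sets borel \<longrightarrow> finite_measure \<rho> \<longrightarrow> finite_first_moment \<rho> \<longrightarrow>
       (\<lambda>n. \<integral>\<^sup>+x. ennreal (dist x (T n x)) \<partial>\<rho>) \<longlonglongrightarrow> 0)"
proof -
  fix z :: 'a
  obtain T :: "nat \<Rightarrow> 'a \<Rightarrow> 'a" where T: "\<And>i. simple_function borel (T i)"
    and lim: "\<And>x. (\<lambda>i. T i x) \<longlonglongrightarrow> x" and bd: "\<And>i x. dist (T i x) z \<le> 2 * dist x z"
    using borel_measurable_implies_sequence_metric[of "\<lambda>x::'a. x" borel z] by auto
  have [measurable]: "T n \<in> borel_measurable borel" for n
    using borel_measurable_simple_function[OF T] .
  show ?thesis
  proof (intro exI conjI allI impI)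
    fix n show "T n \<in> borel_measurable borel" "finite (range (T n))"
      using simple_functionD(1)[OF T[of n]] by simp_all
  next
    fix \<rho> :: "'a measure" assume \<rho>: "sets \<rho> = sets borel" "finite_measure \<rho>" "finite_first_moment \<rho>"
    note [measurable_cong] = \<rho>(1)
    have "(\<lambda>n. \<integral>\<^sup>+x. ennreal (dist x (T n x)) \<partial>\<rho>) \<longlonglongrightarrow> (\<integral>\<^sup>+x. 0 \<partial>\<rho>)"
    \<comment> \<open>The factor 3 is 1 + 2: \<open>dist x (T n x)\<close> is at most
      \<open>dist x z + dist (T n x) z\<close>, and the second term is at most
      \<open>2 * dist x z\<close> by the choice of \<open>T\<close>.\<close>
    proof (rule nn_integral_dominated_convergence[where w = "\<lambda>x. 3 * ennreal (dist x z)"])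
      show "(\<integral>\<^sup>+x. 3 * ennreal (dist x z) \<partial>\<rho>) < \<infinity>"
        using first_moment_finite[OF \<rho>, of z] by (simp add: nn_integral_cmult ennreal_mult_less_top)
      have "dist x (T n x) \<le> 3 * dist x z" for n x
        using dist_triangle2[of x "T n x" z] bd[of n x] by simp
      then have "ennreal (dist x (T n x)) \<le> 3 * ennreal (dist x z)" for n x
        by (metis ennreal_leI ennreal_mult'' ennreal_numeral zero_le_dist)
      then show "AE x in \<rho>. ennreal (dist x (T n x)) \<le> 3 * ennreal (dist x z)" for n
        by simp
      have "(\<lambda>n. ennreal (dist x (T n x))) \<longlonglongrightarrow> ennreal (dist x x)" for x
        by (intro tendsto_ennrealI tendsto_dist tendsto_const lim)
      then show "AE x in \<rho>. (\<lambda>n. ennreal (dist x (T n x))) \<longlonglongrightarrow> 0"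
        by simp
    qed measurable
    then show "(\<lambda>n. \<integral>\<^sup>+x. ennreal (dist x (T n x)) \<partial>\<rho>) \<longlonglongrightarrow> 0"
      by simp
  qed
qed

section \<open>The transport cost depends only on the difference\<close>

lemma nn_integral_dist_simple:
  fixes T :: "'a::{metric_space, second_countable_topology} \<Rightarrow> 'a"
  assumes [measurable]: "T \<in> borel_measurable borel" and V: "finite (range T)"
    and \<pi>: "sets \<pi> = sets (borel :: ('a \<times> 'a) measure)" "finite_measure \<pi>"
  shows "(\<integral>\<^sup>+z. ennreal (dist (T (fst z)) (T (snd z))) \<partial>\<pi>) =
    ennreal (plan_cost (range T) (\<lambda>v w. measure \<pi> ((T -` {v}) \<times> (T -` {w}))))"
proof -
  let ?E = "\<lambda>v w. (T -` {v}) \<times> (T -` {w})"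
  have [measurable]: "T -` {v} \<in> sets borel" for v
    using measurable_sets[OF assms(1), of "{v}"] by simp
  have E[measurable]: "?E v w \<in> sets \<pi>" for v w
    by (simp add: \<pi>(1) flip: borel_prod)
  have "(\<integral>\<^sup>+z. ennreal (dist (T (fst z)) (T (snd z))) \<partial>\<pi>) =
      (\<integral>\<^sup>+z. (\<Sum>v\<in>range T. \<Sum>w\<in>range T. ennreal (dist v w) * indicator (?E v w) z) \<partial>\<pi>)"
  proof (rule nn_integral_cong)
    fix z
    have "(\<Sum>v\<in>range T. \<Sum>w\<in>range T. ennreal (dist v w) * indicator (?E v w) z) =
        (\<Sum>v\<in>range T. if v = T (fst z) then (\<Sum>w\<in>range T. if w = T (snd z) then ennreal (dist v w) else 0) else 0)"
      by (intro sum.cong refl) (auto simp: indicator_def mem_Times_iff intro!: sum.cong)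
    then show "ennreal (dist (T (fst z)) (T (snd z))) =
        (\<Sum>v\<in>range T. \<Sum>w\<in>range T. ennreal (dist v w) * indicator (?E v w) z)"
      using V by simp
  qed
  also have "\<dots> = (\<Sum>v\<in>range T. \<Sum>w\<in>range T. ennreal (dist v w) * emeasure \<pi> (?E v w))"
    by (simp add: nn_integral_sum nn_integral_cmult_indicator)
  also have "\<dots> = ennreal (plan_cost (range T) (\<lambda>v w. measure \<pi> (?E v w)))"
    by (simp add: plan_cost_def sum_nonneg finite_measure.emeasure_eq_measure[OF \<pi>(2)]
        ennreal_mult'' mult.commute flip: sum_ennreal)
  finally show ?thesis .
qed

text \<open>Each error is the integral of a function of one coordinate, so it sees the coupling only
  through a marginal. The same error bound thus holds for all couplings of \<open>\<mu>\<close> and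
  \<open>\<nu>\<close>, in both directions of the discretisation.\<close>

lemma nn_integral_dist_triangle_simple:
  fixes T :: "'a::{metric_space, second_countable_topology} \<Rightarrow> 'a"
  assumes [measurable]: "T \<in> borel_measurable borel"
    and s: "sets \<mu> = sets borel" "sets \<nu> = sets borel" and \<pi>: "\<pi> \<in> couplings \<mu> \<nu>"
  shows "coupling_cost \<pi> \<le>
      (\<integral>\<^sup>+z. ennreal (dist (T (fst z)) (T (snd z))) \<partial>\<pi>)
      + ((\<integral>\<^sup>+x. ennreal (dist x (T x)) \<partial>\<mu>) + (\<integral>\<^sup>+x. ennreal (dist x (T x)) \<partial>\<nu>))"
    and "(\<integral>\<^sup>+z. ennreal (dist (T (fst z)) (T (snd z))) \<partial>\<pi>) \<le>
      coupling_cost \<pi>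
      + ((\<integral>\<^sup>+x. ennreal (dist x (T x)) \<partial>\<mu>) + (\<integral>\<^sup>+x. ennreal (dist x (T x)) \<partial>\<nu>))"
proof -
  have [measurable_cong]: "sets \<pi> = sets borel"
    using \<pi> by (simp add: couplings_def)
  have eq: "(\<integral>\<^sup>+x. ennreal (dist x (T x)) \<partial>\<mu>) = (\<integral>\<^sup>+z. ennreal (dist (fst z) (T (fst z))) \<partial>\<pi>)"
    "(\<integral>\<^sup>+x. ennreal (dist x (T x)) \<partial>\<nu>) = (\<integral>\<^sup>+z. ennreal (dist (snd z) (T (snd z))) \<partial>\<pi>)"
    by (simp_all add: nn_integral_coupling[OF s \<pi>, symmetric])
  have sum: "f + ((\<integral>\<^sup>+x. ennreal (dist x (T x)) \<partial>\<mu>) + (\<integral>\<^sup>+x. ennreal (dist x (T x)) \<partial>\<nu>)) =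
     (\<integral>\<^sup>+z. g z + (ennreal (dist (fst z) (T (fst z))) + ennreal (dist (snd z) (T (snd z)))) \<partial>\<pi>)"
    if "f = (\<integral>\<^sup>+z. g z \<partial>\<pi>)" and [measurable]: "g \<in> borel_measurable \<pi>" for f g
    unfolding eq that(1) by (simp add: nn_integral_add)
  have "dist x y \<le> dist (T x) (T y) + (dist x (T x) + dist y (T y))" for x y
    using dist_triangle[of x y "T x"] dist_triangle2[of "T x" y "T y"] by linarith
  then show "coupling_cost \<pi> \<le>
      (\<integral>\<^sup>+z. ennreal (dist (T (fst z)) (T (snd z))) \<partial>\<pi>)
      + ((\<integral>\<^sup>+x. ennreal (dist x (T x)) \<partial>\<mu>) + (\<integral>\<^sup>+x. ennreal (dist x (T x)) \<partial>\<nu>))"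
    by (subst sum[OF refl]) (auto intro!: nn_integral_mono simp flip: ennreal_plus)
  have "dist (T x) (T y) \<le> dist x y + (dist x (T x) + dist y (T y))" for x y
    using dist_triangle3[of "T x" "T y" x] dist_triangle[of x "T y" y] by linarith
  then show "(\<integral>\<^sup>+z. ennreal (dist (T (fst z)) (T (snd z))) \<partial>\<pi>) \<le>
      coupling_cost \<pi>
      + ((\<integral>\<^sup>+x. ennreal (dist x (T x)) \<partial>\<mu>) + (\<integral>\<^sup>+x. ennreal (dist x (T x)) \<partial>\<nu>))"
    by (subst sum[OF refl]) (auto intro!: nn_integral_mono simp flip: ennreal_plus)
qed

lemma sum_measure_Int_fibres:
  fixes T :: "'a::{metric_space, second_countable_topology} \<Rightarrow> 'a"
  assumes [measurable]: "T \<in> borel_measurable borel" and V: "finite (range T)"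
    and \<mu>: "finite_measure \<mu>" "sets \<mu> = sets borel" and A: "A \<in> sets borel"
  shows "(\<Sum>v\<in>range T. measure \<mu> (A \<inter> T -` {v})) = measure \<mu> A"
proof -
  interpret finite_measure \<mu> by fact
  have "T -` {v} \<in> sets borel" for v
    using measurable_sets[OF assms(1), of "{v}"] by simp
  then have "(\<Sum>v\<in>range T. measure \<mu> (A \<inter> T -` {v})) = measure \<mu> (\<Union>v\<in>range T. A \<inter> T -` {v})"
    using A V by (intro finite_measure_finite_Union[symmetric]) (auto simp: \<mu>(2) disjoint_family_on_def)
  also have "(\<Union>v\<in>range T. A \<inter> T -` {v}) = A"
    by auto
  finally show ?thesis .
qed

text \<open>The density on a rectangle of fibres is the constant entry divided by the product of the
  two fibre masses. Integrating out one variable turns the entries into row or column sums, which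
  cancel against the fibre masses. As \<open>T\<close> is constant on fibres, the discretised cost
  only sees the mass of each rectangle.\<close>

lemma ex_coupling_of_plan:
  fixes T :: "'a::{metric_space, second_countable_topology} \<Rightarrow> 'a"
  assumes T[measurable]: "T \<in> borel_measurable borel" and V: "finite (range T)"
    and \<mu>: "sets \<mu> = sets borel" "finite_measure \<mu>"
    and \<nu>: "sets \<nu> = sets borel" "finite_measure \<nu>"
    and q: "transport_plan (range T) q (\<lambda>v. measure \<mu> (T -` {v})) (\<lambda>v. measure \<nu> (T -` {v}))"
  shows "\<exists>\<pi>\<in>couplings \<mu> \<nu>. (\<integral>\<^sup>+z. ennreal (dist (T (fst z)) (T (snd z))) \<partial>\<pi>) = ennreal (plan_cost (range T) q)"
proof -
  interpret \<mu>: finite_measure \<mu> by fact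
  interpret \<nu>: finite_measure \<nu> by fact
  note [measurable_cong] = \<mu>(1) \<nu>(1)
  define V where "V = range T"
  have fV: "finite V" using V by (simp add: V_def)
  define a where "a v = measure \<mu> (T -` {v})" for v
  define b where "b v = measure \<nu> (T -` {v})" for v
  have q_nn: "0 \<le> q v w" if "v \<in> V" "w \<in> V" for v w
    using q that by (auto simp: transport_plan_def V_def)
  have q_row: "(\<Sum>w\<in>V. q v w) = a v" if "v \<in> V" for v
    using q that by (auto simp: transport_plan_def V_def a_def)
  have q_col: "(\<Sum>v\<in>V. q v w) = b w" if "w \<in> V" for w
    using q that by (auto simp: transport_plan_def V_def b_def)
  have q0a: "q v w = 0" if "v \<in> V" "w \<in> V" "a v = 0" for v w
    using q_row[OF that(1)] that fV by (simp add: sum_nonneg_eq_0_iff q_nn)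
  have q0b: "q v w = 0" if "v \<in> V" "w \<in> V" "b w = 0" for v w
    using q_col[OF that(2)] that fV by (simp add: sum_nonneg_eq_0_iff q_nn)
  have fib[measurable]: "T -` {v} \<in> sets borel" for v
    using measurable_sets[OF T, of "{v}"] by simp
  \<comment> \<open>A null fibre makes the denominator 0 and hence \<open>c v w = 0\<close>. No mass
    is lost, because then \<open>q v w = 0\<close> by \<open>q0a\<close> or
    \<open>q0b\<close>.\<close>
  define c where "c v w = q v w / (a v * b w)" for v w
  have c_nn: "0 \<le> c v w" if "v \<in> V" "w \<in> V" for v w
    using q_nn[OF that] by (simp add: c_def a_def b_def)
  define h where "h z = (\<Sum>v\<in>V. \<Sum>w\<in>V. ennreal (c v w) * indicator ((T -` {v}) \<times> (T -` {w})) z)" for z :: "'a \<times> 'a"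
  have [measurable]: "h \<in> borel_measurable (\<mu> \<Otimes>\<^sub>M \<nu>)"
    unfolding h_def by measurable
  define \<pi> where "\<pi> = density (\<mu> \<Otimes>\<^sub>M \<nu>) h"
  have "sets (\<mu> \<Otimes>\<^sub>M \<nu>) = sets borel"
    using sets_pair_measure_cong[OF \<mu>(1) \<nu>(1)] by (simp only: borel_prod)
  then have s\<pi>: "sets \<pi> = sets borel"
    by (simp add: \<pi>_def)
  have rect: "emeasure \<pi> (A \<times> B) =
      ennreal (\<Sum>v\<in>V. \<Sum>w\<in>V. c v w * (measure \<mu> (A \<inter> T -` {v}) * measure \<nu> (B \<inter> T -` {w})))"
    if [measurable]: "A \<in> sets borel" "B \<in> sets borel" for A B
  proof -
    have "emeasure \<pi> (A \<times> B) = (\<integral>\<^sup>+z. h z * indicator (A \<times> B) z \<partial>(\<mu> \<Otimes>\<^sub>M \<nu>))"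
      unfolding \<pi>_def by (rule emeasure_density) measurable
    also have "\<dots> = (\<integral>\<^sup>+z. (\<Sum>v\<in>V. \<Sum>w\<in>V. ennreal (c v w) *
        indicator ((A \<inter> T -` {v}) \<times> (B \<inter> T -` {w})) z) \<partial>(\<mu> \<Otimes>\<^sub>M \<nu>))"
      unfolding h_def sum_distrib_right
      by (intro nn_integral_cong sum.cong refl) (auto simp: indicator_def)
    also have "\<dots> = (\<Sum>v\<in>V. \<Sum>w\<in>V. ennreal (c v w) *
        emeasure (\<mu> \<Otimes>\<^sub>M \<nu>) ((A \<inter> T -` {v}) \<times> (B \<inter> T -` {w})))"
      by (simp add: nn_integral_sum nn_integral_cmult_indicator)
    also have "\<dots> = (\<Sum>v\<in>V. \<Sum>w\<in>V. ennreal (c v w * (measure \<mu> (A \<inter> T -` {v}) * measure \<nu> (B \<inter> T -` {w}))))"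
      by (intro sum.cong refl)
        (simp add: \<nu>.emeasure_pair_measure_Times \<mu>.emeasure_eq_measure \<nu>.emeasure_eq_measure
          ennreal_mult c_nn)
    also have "\<dots> = ennreal (\<Sum>v\<in>V. \<Sum>w\<in>V. c v w * (measure \<mu> (A \<inter> T -` {v}) * measure \<nu> (B \<inter> T -` {w})))"
      by (simp add: sum_nonneg c_nn)
    finally show ?thesis .
  qed
  have left: "emeasure \<mu> A = emeasure \<pi> (A \<times> UNIV)" if A: "A \<in> sets borel" for A
  proof -
    have "(\<Sum>w\<in>V. c v w * (measure \<mu> (A \<inter> T -` {v}) * measure \<nu> (UNIV \<inter> T -` {w}))) = measure \<mu> (A \<inter> T -` {v})"
      if v: "v \<in> V" for v
    proof (cases "a v = 0")
      case True
      then have "measure \<mu> (A \<inter> T -` {v}) = 0"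
        using \<mu>.finite_measure_mono[of "A \<inter> T -` {v}" "T -` {v}"] measure_nonneg[of \<mu> "A \<inter> T -` {v}"]
        by (simp add: a_def \<mu>(1))
      then show ?thesis by simp
    next
      case False
      have "(\<Sum>w\<in>V. c v w * (measure \<mu> (A \<inter> T -` {v}) * measure \<nu> (UNIV \<inter> T -` {w}))) =
          (\<Sum>w\<in>V. measure \<mu> (A \<inter> T -` {v}) / a v * q v w)"
        using q0b[OF v] by (intro sum.cong refl) (auto simp: c_def simp flip: b_def)
      also have "\<dots> = measure \<mu> (A \<inter> T -` {v})"
        unfolding sum_distrib_left[symmetric] q_row[OF v] using False by simp
      finally show ?thesis .
    qed
    then show ?thesis
      using A sum_measure_Int_fibres[OF T V \<mu>(2,1) A]
      by (simp add: rect \<mu>.emeasure_eq_measure V_def)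
  qed
  have right: "emeasure \<nu> A = emeasure \<pi> (UNIV \<times> A)" if A: "A \<in> sets borel" for A
  proof -
    have "(\<Sum>v\<in>V. c v w * (measure \<mu> (UNIV \<inter> T -` {v}) * measure \<nu> (A \<inter> T -` {w}))) = measure \<nu> (A \<inter> T -` {w})"
      if w: "w \<in> V" for w
    proof (cases "b w = 0")
      case True
      then have "measure \<nu> (A \<inter> T -` {w}) = 0"
        using \<nu>.finite_measure_mono[of "A \<inter> T -` {w}" "T -` {w}"] measure_nonneg[of \<nu> "A \<inter> T -` {w}"]
        by (simp add: b_def \<nu>(1))
      then show ?thesis by simp
    next
      case False
      have "(\<Sum>v\<in>V. c v w * (measure \<mu> (UNIV \<inter> T -` {v}) * measure \<nu> (A \<inter> T -` {w}))) =
          (\<Sum>v\<in>V. measure \<nu> (A \<inter> T -` {w}) / b w * q v w)"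
        using q0a[OF _ w] by (intro sum.cong refl) (auto simp: c_def simp flip: a_def)
      also have "\<dots> = measure \<nu> (A \<inter> T -` {w})"
        unfolding sum_distrib_left[symmetric] q_col[OF w] using False by simp
      finally show ?thesis .
    qed
    then show ?thesis
      using A sum_measure_Int_fibres[OF T V \<nu>(2,1) A]
      by (subst rect, simp, simp, subst sum.swap) (simp add: \<nu>.emeasure_eq_measure V_def)
  qed
  have coup: "\<pi> \<in> couplings \<mu> \<nu>"
    using s\<pi> left right by (auto simp: couplings_def)
  interpret \<pi>: finite_measure \<pi>
    by (rule finite_measure_coupling[OF \<mu>(2,1) coup])
  have cell: "measure \<pi> ((T -` {v}) \<times> (T -` {w})) = q v w" if vw: "v \<in> V" "w \<in> V" for v w
  proof -
    have m: "measure M (T -` {v} \<inter> T -` {v'}) = (if v' = v then measure M (T -` {v}) else 0)"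
      for v v' and M :: "'a measure"
    proof (cases "v' = v")
      case False
      then have "T -` {v} \<inter> T -` {v'} = {}" by auto
      with False show ?thesis by simp
    qed simp
    have "emeasure \<pi> ((T -` {v}) \<times> (T -` {w})) =
      ennreal (\<Sum>v'\<in>V. if v' = v then (\<Sum>w'\<in>V. if w' = w then c v' w' * (a v * b w) else 0) else 0)"
      unfolding rect[OF fib fib] m
      by (intro arg_cong[where f = ennreal] sum.cong refl) (auto simp: a_def b_def intro!: sum.cong)
    also have "\<dots> = ennreal (q v w)"
      using fV vw q0a[OF vw] q0b[OF vw] by (auto simp: c_def)
    finally show ?thesis
      using q_nn[OF vw] by (simp add: measure_def)
  qed
  have "plan_cost (range T) (\<lambda>v w. measure \<pi> ((T -` {v}) \<times> (T -` {w}))) = plan_cost (range T) q"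
    unfolding plan_cost_def using cell by (intro sum.cong refl) (simp add: V_def)
  with nn_integral_dist_simple[OF T V s\<pi> \<pi>.finite_measure_axioms] coup show ?thesis
    by auto
qed

lemma coupling_cost_le_of_same_difference:
  fixes \<mu> \<nu> \<mu>' \<nu>' :: "'a::{metric_space, second_countable_topology} measure"
  assumes kr: "kr_pair \<mu> \<nu>" "kr_pair \<mu>' \<nu>'"
    and diff: "measure_diff \<mu>' \<nu>' = measure_diff \<mu> \<nu>" and \<pi>: "\<pi> \<in> couplings \<mu>' \<nu>'"
  shows "(INF \<pi>\<in>couplings \<mu> \<nu>. coupling_cost \<pi>)
      \<le> coupling_cost \<pi>" (is "?I \<le> ?c \<pi>")
proof -
  have s: "sets \<mu> = sets borel" "sets \<nu> = sets borel" "sets \<mu>' = sets borel" "sets \<nu>' = sets borel"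
    and f: "finite_measure \<mu>" "finite_measure \<nu>" "finite_measure \<mu>'" "finite_measure \<nu>'"
    and mom: "finite_first_moment \<mu>" "finite_first_moment \<nu>" "finite_first_moment \<mu>'" "finite_first_moment \<nu>'"
    using kr by (auto simp: kr_pair_def)
  have s\<pi>: "sets \<pi> = sets borel"
    using \<pi> by (simp add: couplings_def)
  have f\<pi>: "finite_measure \<pi>"
    by (rule finite_measure_coupling[OF f(3) s(3) \<pi>])
  obtain T :: "nat \<Rightarrow> 'a \<Rightarrow> 'a" where T: "\<And>n. T n \<in> borel_measurable borel" "\<And>n. finite (range (T n))"
    and lim: "\<And>\<rho>. sets \<rho> = sets borel \<Longrightarrow> finite_measure \<rho> \<Longrightarrow> finite_first_moment \<rho> \<Longrightarrow>
       (\<lambda>n. \<integral>\<^sup>+x. ennreal (dist x (T n x)) \<partial>\<rho>) \<longlonglongrightarrow> 0"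
    using ex_simple_retraction_sequence[where 'a='a] by blast
  define e where "e n \<rho> = (\<integral>\<^sup>+x. ennreal (dist x (T n x)) \<partial>\<rho>)" for n \<rho>
  \<comment> \<open>The primed errors are paid for turning \<open>\<pi>\<close> into a finite plan,
    the unprimed ones for passing from the rerouted plan to a true coupling of \<open>\<mu>\<close>
    and \<open>\<nu>\<close>.\<close>
  have "?I \<le> (?c \<pi> + (e n \<mu>' + e n \<nu>')) + (e n \<mu> + e n \<nu>)" for n
  proof -
    have fib: "T n -` {v} \<in> sets borel" for v
      using measurable_sets[OF T(1), of "{v}" n] by simp
    define p where "p v w = measure \<pi> ((T n -` {v}) \<times> (T n -` {w}))" for v w
    have marg: "measure \<mu>' A = measure \<pi> (A \<times> UNIV)" "measure \<nu>' A = measure \<pi> (UNIV \<times> A)" if "A \<in> sets borel" for A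
      using \<pi> that by (simp_all add: couplings_def measure_def)
    have "transport_plan (range (T n)) p (\<lambda>v. measure \<mu>' (T n -` {v})) (\<lambda>v. measure \<nu>' (T n -` {v}))"
    proof -
      interpret \<pi>: finite_measure \<pi> by fact
      have [simp]: "(T n -` {v}) \<times> (T n -` {w}) \<in> sets \<pi>" for v w
        using fib by (simp add: s\<pi> flip: borel_prod)
      have "(\<Sum>w\<in>range (T n). p v w) = measure \<pi> (\<Union>w\<in>range (T n). (T n -` {v}) \<times> (T n -` {w}))" for v
        unfolding p_def using T(2) by (intro \<pi>.finite_measure_finite_Union[symmetric]) (auto simp: disjoint_family_on_def)
      moreover have "(\<Union>w\<in>range (T n). (T n -` {v}) \<times> (T n -` {w})) = (T n -` {v}) \<times> UNIV" for v
        by auto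
      moreover have "(\<Sum>v\<in>range (T n). p v w) = measure \<pi> (\<Union>v\<in>range (T n). (T n -` {v}) \<times> (T n -` {w}))" for w
        unfolding p_def using T(2) by (intro \<pi>.finite_measure_finite_Union[symmetric]) (auto simp: disjoint_family_on_def)
      moreover have "(\<Union>v\<in>range (T n). (T n -` {v}) \<times> (T n -` {w})) = UNIV \<times> (T n -` {w})" for w
        by auto
      ultimately show ?thesis
        by (simp add: transport_plan_def marg fib) (simp add: p_def)
    qed
    \<comment> \<open>Since the same \<open>T n\<close> is applied to all measures, equality of the
      differences passes to the fibre masses, which are the prescribed row and column sums.\<close>
    moreover have "measure \<mu>' (T n -` {v}) - measure \<nu>' (T n -` {v}) = measure \<mu> (T n -` {v}) - measure \<nu> (T n -` {v})" for v
      using fun_cong[OF diff] by (simp add: measure_diff_def)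
    ultimately obtain q where q: "transport_plan (range (T n)) q (\<lambda>v. measure \<mu> (T n -` {v})) (\<lambda>v. measure \<nu> (T n -` {v}))"
      and qp: "plan_cost (range (T n)) q \<le> plan_cost (range (T n)) p"
      using transport_plan_of_same_difference[OF _ T(2)[of n]] measure_nonneg by meson
    obtain \<sigma> where \<sigma>: "\<sigma> \<in> couplings \<mu> \<nu>"
      and c\<sigma>: "(\<integral>\<^sup>+z. ennreal (dist (T n (fst z)) (T n (snd z))) \<partial>\<sigma>) = ennreal (plan_cost (range (T n)) q)"
      using ex_coupling_of_plan[OF T s(1) f(1) s(2) f(2) q] by blast
    have "?I \<le> ?c \<sigma>"
      by (rule INF_lower[OF \<sigma>])
    also have "\<dots> \<le> ennreal (plan_cost (range (T n)) q) + (e n \<mu> + e n \<nu>)"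
      using nn_integral_dist_triangle_simple(1)[OF T(1)[of n] s(1,2) \<sigma>] by (simp only: e_def c\<sigma>)
    also have "\<dots> \<le> ennreal (plan_cost (range (T n)) p) + (e n \<mu> + e n \<nu>)"
      by (intro add_right_mono ennreal_leI qp)
    also have "ennreal (plan_cost (range (T n)) p) = (\<integral>\<^sup>+z. ennreal (dist (T n (fst z)) (T n (snd z))) \<partial>\<pi>)"
      by (simp add: nn_integral_dist_simple[OF T s\<pi> f\<pi>] p_def[abs_def])
    also have "\<dots> \<le> ?c \<pi> + (e n \<mu>' + e n \<nu>')"
      using nn_integral_dist_triangle_simple(2)[OF T(1)[of n] s(3,4) \<pi>] by (simp only: e_def)
    finally show ?thesis
      by (simp add: add_right_mono)
  qed
  moreover have "(\<lambda>n. (?c \<pi> + (e n \<mu>' + e n \<nu>')) + (e n \<mu> + e n \<nu>)) \<longlonglongrightarrow> (?c \<pi> + (0 + 0)) + (0 + 0)"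
    unfolding e_def by (intro tendsto_add tendsto_const lim s f mom)
  ultimately show ?thesis
    by (intro LIMSEQ_le_const) auto
qed

section \<open>The Kantorovich-Rubinstein norm\<close>

lemma kr_pair_commute: "kr_pair \<mu> \<nu> \<longleftrightarrow> kr_pair \<nu> \<mu>"
  by (auto simp: kr_pair_def)

lemma kr_pairD:
  assumes "kr_pair \<mu> \<nu>"
  shows "sets \<mu> = sets borel" "sets \<nu> = sets borel" "finite_measure \<mu>" "finite_measure \<nu>"
    "finite_first_moment \<mu>" "finite_first_moment \<nu>" "emeasure \<mu> UNIV = emeasure \<nu> UNIV"
  using assms by (auto simp: kr_pair_def)

text \<open>A constant map has a single fibre, and the plan is a 1 by 1 matrix holding the total
  mass. The lifted coupling is the normalised product measure, and its cost is at most the sum of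
  the two first moments.\<close>

lemma ex_coupling_finite_cost:
  fixes \<mu> \<nu> :: "'a::{metric_space, second_countable_topology} measure"
  assumes kr: "kr_pair \<mu> \<nu>"
  shows "\<exists>\<pi>\<in>couplings \<mu> \<nu>. coupling_cost \<pi> < \<infinity>"
proof -
  fix z :: 'a
  note D = kr_pairD[OF kr]
  have "transport_plan (range (\<lambda>_::'a. z)) (\<lambda>_ _. measure \<mu> UNIV)
      (\<lambda>v. measure \<mu> ((\<lambda>_::'a. z) -` {v})) (\<lambda>v. measure \<nu> ((\<lambda>_::'a. z) -` {v}))"
    using D(7) by (simp add: transport_plan_def measure_def)
  from ex_coupling_of_plan[OF _ _ D(1,3,2,4) this]
  obtain \<pi> where \<pi>: "\<pi> \<in> couplings \<mu> \<nu>"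
    by auto
  have "coupling_cost \<pi> \<le> (\<integral>\<^sup>+_. ennreal (dist z z) \<partial>\<pi>)
      + ((\<integral>\<^sup>+x. ennreal (dist x z) \<partial>\<mu>) + (\<integral>\<^sup>+x. ennreal (dist x z) \<partial>\<nu>))"
    using nn_integral_dist_triangle_simple(1)[of "\<lambda>_. z", OF _ D(1,2) \<pi>] by simp
  also have "\<dots> < \<infinity>"
    using first_moment_finite[OF D(1,3,5)] first_moment_finite[OF D(2,4,6)] by simp
  finally show ?thesis
    using \<pi> by blast
qed

text \<open>\<open>enn2real\<close> sends infinity to 0; a coupling of finite cost excludes this
  case, so \<open>kr_cost\<close> is the true infimum.\<close>

lemma ennreal_kr_cost:
  fixes \<mu> \<nu> :: "'a::{metric_space, second_countable_topology} measure"
  assumes "kr_pair \<mu> \<nu>"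
  shows "ennreal (kr_cost \<mu> \<nu>) = (INF \<pi>\<in>couplings \<mu> \<nu>. coupling_cost \<pi>)"
proof -
  have "(INF \<pi>\<in>couplings \<mu> \<nu>. coupling_cost \<pi>) < \<infinity>"
    using ex_coupling_finite_cost[OF assms] by (auto simp: INF_less_iff)
  then show ?thesis
    by (simp add: kr_cost_def)
qed

text \<open>The description has at most one solution, because the given pair is among those it
  quantifies over. Comparing two pairs in both directions shows that this value serves for all of
  them.\<close>

lemma kr_norm_eq_kr_cost:
  fixes \<mu> \<nu> :: "'a::{metric_space, second_countable_topology} measure"
  assumes kr: "kr_pair \<mu> \<nu>"
  shows "kr_norm (measure_diff \<mu> \<nu>) = kr_cost \<mu> \<nu>"
proof -
  have *: "kr_cost \<mu> \<nu> = kr_cost \<mu>' \<nu>'"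
    if "kr_pair \<mu>' \<nu>'" "measure_diff \<mu> \<nu> = measure_diff \<mu>' \<nu>'" for \<mu>' \<nu>' :: "'a measure"
  proof -
    have "(INF \<pi>\<in>couplings \<mu> \<nu>. coupling_cost \<pi>) = (INF \<pi>\<in>couplings \<mu>' \<nu>'. coupling_cost \<pi>)"
      using coupling_cost_le_of_same_difference[OF kr that(1) that(2)[symmetric]]
        coupling_cost_le_of_same_difference[OF that(1) kr that(2)]
      by (intro antisym INF_greatest)
    then show ?thesis
      by (simp add: kr_cost_def)
  qed
  show ?thesis
    unfolding kr_norm_def by (rule the_equality) (use kr * in blast)+
qed

lemma kr_norm_measure_diff:
  fixes \<mu> \<nu> :: "'a::{metric_space, second_countable_topology} measure"
  assumes "kr_pair \<mu> \<nu>"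
  shows "ennreal (kr_norm (measure_diff \<mu> \<nu>)) = (INF \<pi>\<in>couplings \<mu> \<nu>. coupling_cost \<pi>)"
  using kr_norm_eq_kr_cost[OF assms] ennreal_kr_cost[OF assms] by simp

lemma kr_norm_nonneg:
  fixes m :: "'a::{metric_space, second_countable_topology} set \<Rightarrow> real"
  assumes "m \<in> KRM"
  shows "0 \<le> kr_norm m"
  using assms by (auto simp: KRM_def kr_norm_eq_kr_cost) (simp add: kr_cost_def)

lemma kr_norm_le_coupling_cost:
  fixes \<mu> \<nu> :: "'a::{metric_space, second_countable_topology} measure"
  assumes "kr_pair \<mu> \<nu>" "\<pi> \<in> couplings \<mu> \<nu>" "coupling_cost \<pi> \<le> ennreal c" "0 \<le> c"
  shows "kr_norm (measure_diff \<mu> \<nu>) \<le> c"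
proof -
  have "ennreal (kr_norm (measure_diff \<mu> \<nu>)) \<le> ennreal c"
    using assms(3) INF_lower[OF assms(2), of coupling_cost]
    by (simp add: kr_norm_measure_diff[OF assms(1)])
  with \<open>0 \<le> c\<close> show ?thesis
    by simp
qed

text \<open>Source of nearly optimal couplings: later estimates take one of cost below the norm plus
  a margin, and let the margin tend to 0.\<close>

lemma kr_norm_ex_coupling:
  fixes \<mu> \<nu> :: "'a::{metric_space, second_countable_topology} measure"
  assumes "kr_pair \<mu> \<nu>" "kr_norm (measure_diff \<mu> \<nu>) < c"
  shows "\<exists>\<pi>\<in>couplings \<mu> \<nu>. coupling_cost \<pi> < ennreal c"
proof -
  have "0 \<le> kr_norm (measure_diff \<mu> \<nu>)"
    using assms by (intro kr_norm_nonneg) (auto simp: KRM_def)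
  with assms(2) have "ennreal (kr_norm (measure_diff \<mu> \<nu>)) < ennreal c"
    by (simp add: ennreal_lessI)
  then show ?thesis
    by (simp add: kr_norm_measure_diff[OF assms(1)] INF_less_iff)
qed

section \<open>Vector space structure and subadditivity\<close>

text \<open>Swapping the coordinates of a coupling exchanges its marginals and keeps
  distances.\<close>

lemma KRM_uminus:
  fixes m :: "'a::{metric_space, second_countable_topology} set \<Rightarrow> real"
  assumes "m \<in> KRM"
  shows "(\<lambda>A. - m A) \<in> KRM" and "kr_norm (\<lambda>A. - m A) \<le> kr_norm m"
proof -
  obtain \<mu> \<nu> where kr: "kr_pair \<mu> \<nu>" and m: "m = measure_diff \<mu> \<nu>"
    using assms by (auto simp: KRM_def)
  have kr': "kr_pair \<nu> \<mu>"
    using kr kr_pair_commute by blast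
  have m': "(\<lambda>A. - m A) = measure_diff \<nu> \<mu>"
    by (simp add: m measure_diff_def)
  show "(\<lambda>A. - m A) \<in> KRM"
    using kr' m' by (auto simp: KRM_def)
  show "kr_norm (\<lambda>A. - m A) \<le> kr_norm m"
  proof (rule field_le_epsilon)
    fix e :: real assume "0 < e"
    then obtain \<pi> where \<pi>: "\<pi> \<in> couplings \<mu> \<nu>" "coupling_cost \<pi> < ennreal (kr_norm m + e)"
      using kr_norm_ex_coupling[OF kr, of "kr_norm m + e"] by (auto simp: m)
    have s: "sets \<pi> = sets borel" and d: "distr \<pi> borel fst = \<mu>" "distr \<pi> borel snd = \<nu>"
      using \<pi>(1) couplings_iff[OF kr_pairD(1,2)[OF kr]] by blast+
    note [measurable_cong] = s
    define sw where "sw z = (snd z, fst z)" for z :: "'a \<times> 'a"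
    have [measurable]: "sw \<in> borel_measurable borel"
      unfolding sw_def by measurable
    have "distr (distr \<pi> borel sw) borel fst = \<nu>" "distr (distr \<pi> borel sw) borel snd = \<mu>"
      by (simp_all add: distr_distr comp_def sw_def d)
    then have "distr \<pi> borel sw \<in> couplings \<nu> \<mu>"
      by (simp add: couplings_iff[OF kr_pairD(1,2)[OF kr']])
    moreover have "coupling_cost (distr \<pi> borel sw) = coupling_cost \<pi>"
      by (simp add: nn_integral_distr) (simp add: sw_def dist_commute)
    ultimately show "kr_norm (\<lambda>A. - m A) \<le> kr_norm m + e"
      unfolding m' using \<pi>(2) kr_norm_nonneg[OF assms] \<open>0 < e\<close>
      by (intro kr_norm_le_coupling_cost[OF kr']) auto
  qed
qed

lemma KRM_scale:
  fixes m :: "'a::{metric_space, second_countable_topology} set \<Rightarrow> real"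
  assumes "m \<in> KRM" and r: "0 \<le> r"
  shows "(\<lambda>A. r * m A) \<in> KRM" and "kr_norm (\<lambda>A. r * m A) \<le> r * kr_norm m"
proof -
  obtain \<mu> \<nu> where kr: "kr_pair \<mu> \<nu>" and m: "m = measure_diff \<mu> \<nu>"
    using assms by (auto simp: KRM_def)
  note D = kr_pairD[OF kr]
  have mom: "finite_first_moment (scale_measure (ennreal r) \<rho>)"
    if "sets \<rho> = sets borel" "finite_measure \<rho>" "finite_first_moment \<rho>" for \<rho> :: "'a measure"
    unfolding finite_first_moment_def using first_moment_finite[OF that, of undefined]
    by (intro exI[of _ undefined], subst nn_integral_scale_measure)
      (auto simp: measurable_cong_sets[OF that(1) refl] ennreal_mult_less_top)
  have kr': "kr_pair (scale_measure (ennreal r) \<mu>) (scale_measure (ennreal r) \<nu>)"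
    using D mom by (auto simp: kr_pair_def finite_measure_scale_measure)
  have m': "(\<lambda>A. r * m A) = measure_diff (scale_measure (ennreal r) \<mu>) (scale_measure (ennreal r) \<nu>)"
    using r by (simp add: m measure_diff_def measure_def enn2real_mult right_diff_distrib)
  show "(\<lambda>A. r * m A) \<in> KRM"
    using kr' m' by (auto simp: KRM_def)
  show "kr_norm (\<lambda>A. r * m A) \<le> r * kr_norm m"
  proof (rule field_le_epsilon)
    fix e :: real assume e: "0 < e"
    \<comment> \<open>Dividing by \<open>r + 1\<close> instead of \<open>r\<close> covers
      \<open>r = 0\<close> and still gives \<open>r * \<delta> \<le> e\<close>.\<close>
    define \<delta> where "\<delta> = e / (r + 1)"
    have \<delta>: "0 < \<delta>" "r * \<delta> \<le> e"
      using e r by (auto simp: \<delta>_def field_simps)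
    then obtain \<pi> where \<pi>: "\<pi> \<in> couplings \<mu> \<nu>" "coupling_cost \<pi> < ennreal (kr_norm m + \<delta>)"
      using kr_norm_ex_coupling[OF kr, of "kr_norm m + \<delta>"] by (auto simp: m)
    have [measurable_cong]: "sets \<pi> = sets borel"
      using \<pi>(1) by (simp add: couplings_def)
    have "scale_measure (ennreal r) \<pi> \<in> couplings (scale_measure (ennreal r) \<mu>) (scale_measure (ennreal r) \<nu>)"
      using \<pi>(1) by (auto simp: couplings_def)
    moreover have "coupling_cost (scale_measure (ennreal r) \<pi>) \<le> ennreal (r * (kr_norm m + \<delta>))"
      using \<pi>(2) kr_norm_nonneg[OF assms(1)] r \<delta>
      by (subst nn_integral_scale_measure) (auto simp: ennreal_mult intro!: mult_left_mono)
    ultimately have "kr_norm (\<lambda>A. r * m A) \<le> r * (kr_norm m + \<delta>)"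
      unfolding m' using kr_norm_nonneg[OF assms(1)] r \<delta>
      by (intro kr_norm_le_coupling_cost[OF kr']) auto
    then show "kr_norm (\<lambda>A. r * m A) \<le> r * kr_norm m + e"
      using \<delta>(2) by (simp add: distrib_left)
  qed
qed

lemma KRM_add:
  fixes m m' :: "'a::{metric_space, second_countable_topology} set \<Rightarrow> real"
  assumes "m \<in> KRM" "m' \<in> KRM"
  shows "(\<lambda>A. m A + m' A) \<in> KRM" and "kr_norm (\<lambda>A. m A + m' A) \<le> kr_norm m + kr_norm m'"
proof -
  obtain \<mu> \<nu> where kr: "kr_pair \<mu> \<nu>" and m: "m = measure_diff \<mu> \<nu>"
    using assms by (auto simp: KRM_def)
  obtain \<mu>' \<nu>' where kr': "kr_pair \<mu>' \<nu>'" and m': "m' = measure_diff \<mu>' \<nu>'"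
    using assms by (auto simp: KRM_def)
  note D = kr_pairD[OF kr] and D' = kr_pairD[OF kr']
  have mom: "finite_first_moment (add_measure \<rho> \<rho>')"
    if "sets \<rho> = sets borel" "finite_measure \<rho>" "finite_first_moment \<rho>"
      "sets \<rho>' = sets borel" "finite_measure \<rho>'" "finite_first_moment \<rho>'" for \<rho> \<rho>' :: "'a measure"
    unfolding finite_first_moment_def
    using first_moment_finite[OF that(1-3), of undefined] first_moment_finite[OF that(4-6), of undefined]
    by (intro exI[of _ undefined], subst nn_integral_add_measure)
      (auto simp: measurable_cong_sets[OF that(1) refl] that)
  have kr'': "kr_pair (add_measure \<mu> \<mu>') (add_measure \<nu> \<nu>')"
    using D D' mom by (simp add: kr_pair_def finite_measure_add_measure)
  have eq: "(\<lambda>A. m A + m' A) = measure_diff (add_measure \<mu> \<mu>') (add_measure \<nu> \<nu>')"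
    using D D' by (simp add: m m' measure_diff_def measure_add_measure fun_eq_iff)
  show "(\<lambda>A. m A + m' A) \<in> KRM"
    using kr'' eq by (auto simp: KRM_def)
  show "kr_norm (\<lambda>A. m A + m' A) \<le> kr_norm m + kr_norm m'"
  proof (rule field_le_epsilon)
    fix e :: real assume e: "0 < e"
    then obtain \<pi> where \<pi>: "\<pi> \<in> couplings \<mu> \<nu>" "coupling_cost \<pi> < ennreal (kr_norm m + e/2)"
      using kr_norm_ex_coupling[OF kr, of "kr_norm m + e/2"] by (auto simp: m)
    obtain \<pi>' where \<pi>': "\<pi>' \<in> couplings \<mu>' \<nu>'" "coupling_cost \<pi>' < ennreal (kr_norm m' + e/2)"
      using kr_norm_ex_coupling[OF kr', of "kr_norm m' + e/2"] e by (auto simp: m')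
    have s: "sets \<pi> = sets borel" "sets \<pi>' = sets borel"
      using \<pi>(1) \<pi>'(1) by (simp_all add: couplings_def)
    note [measurable_cong] = s(1)
    have "add_measure \<pi> \<pi>' \<in> couplings (add_measure \<mu> \<mu>') (add_measure \<nu> \<nu>')"
      using \<pi>(1) \<pi>'(1) D D' by (simp add: couplings_def)
    moreover have "coupling_cost (add_measure \<pi> \<pi>') = coupling_cost \<pi> + coupling_cost \<pi>'"
      using s by (intro nn_integral_add_measure) auto
    moreover have "\<dots> \<le> ennreal ((kr_norm m + e/2) + (kr_norm m' + e/2))"
      using \<pi>(2) \<pi>'(2) e kr_norm_nonneg[OF assms(1)] kr_norm_nonneg[OF assms(2)]
      by (subst ennreal_plus) (auto intro!: add_mono)
    ultimately have "kr_norm (\<lambda>A. m A + m' A) \<le> (kr_norm m + e/2) + (kr_norm m' + e/2)"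
      unfolding eq using kr_norm_nonneg[OF assms(1)] kr_norm_nonneg[OF assms(2)] e
      by (intro kr_norm_le_coupling_cost[OF kr'']) auto
    then show "kr_norm (\<lambda>A. m A + m' A) \<le> kr_norm m + kr_norm m' + e"
      by simp
  qed
qed

lemma KRM_lincomb:
  fixes m m' :: "'a::{metric_space, second_countable_topology} set \<Rightarrow> real"
  assumes "m \<in> KRM" "m' \<in> KRM"
  shows "(\<lambda>A. a * m A + b * m' A) \<in> KRM"
    and "kr_norm (\<lambda>A. a * m A + b * m' A) \<le> \<bar>a\<bar> * kr_norm m + \<bar>b\<bar> * kr_norm m'"
proof -
  have mult: "(\<lambda>A. r * n A) \<in> KRM \<and> kr_norm (\<lambda>A. r * n A) \<le> \<bar>r\<bar> * kr_norm n"
    if n: "n \<in> KRM" for r and n :: "'a set \<Rightarrow> real"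
  proof (cases "0 \<le> r")
    case True
    then show ?thesis
      using KRM_scale[OF n] by simp
  next
    case False
    then have "(\<lambda>A. - r * n A) \<in> KRM" "kr_norm (\<lambda>A. - r * n A) \<le> \<bar>r\<bar> * kr_norm n"
      using KRM_scale[OF n, of "- r"] by simp_all
    then show ?thesis
      using KRM_uminus[of "\<lambda>A. - r * n A"] by simp
  qed
  show "(\<lambda>A. a * m A + b * m' A) \<in> KRM"
    using mult assms KRM_add(1) by blast
  show "kr_norm (\<lambda>A. a * m A + b * m' A) \<le> \<bar>a\<bar> * kr_norm m + \<bar>b\<bar> * kr_norm m'"
    using mult[OF assms(1), of a] mult[OF assms(2), of b]
      KRM_add(2)[of "\<lambda>A. a * m A" "\<lambda>A. b * m' A"] by linarith
qed

section \<open>Definiteness\<close>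

text \<open>Mass that starts in \<open>C\<close> either arrives within \<open>\<delta>\<close> of
  \<open>C\<close> or travels at least \<open>\<delta>\<close>. The second kind is the set
  \<open>?F\<close>, whose mass Markov's inequality bounds by the cost divided by
  \<open>\<delta>\<close>.\<close>

lemma emeasure_closed_le_of_coupling:
  fixes \<mu> \<nu> :: "'a::{metric_space, second_countable_topology} measure"
  assumes \<pi>: "\<pi> \<in> couplings \<mu> \<nu>" and C: "closed C" "C \<noteq> {}" and \<delta>: "0 < \<delta>"
  shows "emeasure \<mu> C \<le> emeasure \<nu> {y. infdist y C \<le> \<delta>} + ennreal (1 / \<delta>) * coupling_cost \<pi>"
proof -
  have [measurable_cong]: "sets \<pi> = sets borel"
    using \<pi> by (simp add: couplings_def)
  let ?D = "{y. infdist y C \<le> \<delta>}" and ?F = "{z\<in>UNIV. 1 \<le> ennreal (1 / \<delta>) * ennreal (dist (fst z) (snd z))}"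
  have [measurable]: "C \<in> sets borel" "?D \<in> sets borel"
    using C by (auto intro!: borel_closed closed_Collect_le continuous_intros)
  have far: "1 \<le> ennreal (1 / \<delta>) * ennreal (dist x y)" if "x \<in> C" "\<not> infdist y C \<le> \<delta>" for x y
  proof -
    have "\<delta> \<le> dist x y"
      using infdist_le[OF that(1), of y] that(2) by (simp add: dist_commute)
    then have "1 \<le> 1 / \<delta> * dist x y"
      using \<delta> by (simp add: field_simps)
    then show ?thesis
      using \<delta> by (simp flip: ennreal_mult ennreal_1)
  qed
  have sp: "space \<pi> = UNIV"
    using sets_eq_imp_space_eq[OF \<open>sets \<pi> = sets borel\<close>] by simp
  have rect: "UNIV \<times> ?D \<in> sets \<pi>"
    by (simp add: \<open>sets \<pi> = sets borel\<close> flip: borel_prod)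
  have "{z\<in>space \<pi>. 1 \<le> ennreal (1 / \<delta>) * ennreal (dist (fst z) (snd z))} \<in> sets \<pi>"
    by measurable
  then have F: "?F \<in> sets \<pi>"
    by (simp only: sp)
  have "emeasure \<mu> C = emeasure \<pi> (C \<times> UNIV)"
    using \<pi> by (auto simp: couplings_def)
  also have "\<dots> \<le> emeasure \<pi> ((UNIV \<times> ?D) \<union> ?F)"
  proof (rule emeasure_mono)
    show "C \<times> UNIV \<subseteq> (UNIV \<times> ?D) \<union> ?F"
      by clarsimp (use far in blast)
  qed (intro sets.Un rect F)
  also have "\<dots> \<le> emeasure \<pi> (UNIV \<times> ?D) + emeasure \<pi> ?F"
    by (intro emeasure_subadditive rect F)
  also have "emeasure \<pi> (UNIV \<times> ?D) = emeasure \<nu> ?D"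
    using \<pi> by (auto simp: couplings_def)
  also have "emeasure \<pi> ?F \<le> ennreal (1 / \<delta>) * coupling_cost \<pi>"
    using nn_integral_Markov_inequality[of "\<lambda>z. ennreal (dist (fst z) (snd z))" UNIV \<pi> "ennreal (1 / \<delta>)"]
    by (simp add: sp flip: sp)
  finally show ?thesis
    by (simp add: add_left_mono)
qed

text \<open>The preceding bound is applied at scales \<open>\<delta> n\<close> tending to 0. The
  neighbourhoods \<open>E n\<close> decrease to \<open>C\<close> because \<open>C\<close> is closed,
  and the finite measure \<open>\<nu>\<close> is continuous from above.\<close>

lemma measure_closed_le_of_kr_norm_eq_0:
  fixes \<mu> \<nu> :: "'a::{metric_space, second_countable_topology} measure"
  assumes kr: "kr_pair \<mu> \<nu>" and 0: "kr_norm (measure_diff \<mu> \<nu>) \<le> 0" and C: "closed C"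
  shows "measure \<mu> C \<le> measure \<nu> C"
\<comment> \<open>The empty set is split off because \<open>infdist\<close> to it is 0 by
  convention, so its neighbourhoods would be the whole space.\<close>
proof (cases "C = {}")
  case False
  note D = kr_pairD[OF kr]
  interpret \<mu>: finite_measure \<mu> by (rule D(3))
  interpret \<nu>: finite_measure \<nu> by (rule D(4))
  define \<delta> where "\<delta> n = inverse (real (Suc n))" for n
  define E where "E n = {y. infdist y C \<le> \<delta> n}" for n
  have \<delta>: "0 < \<delta> n" for n
    by (simp add: \<delta>_def)
  have \<delta>lim: "\<delta> \<longlonglongrightarrow> 0"
    unfolding \<delta>_def by (rule LIMSEQ_inverse_real_of_nat)
  have le: "measure \<mu> C \<le> measure \<nu> (E n) + \<delta> n" for n
  proof -
    \<comment> \<open>The square is chosen so that \<open>\<delta> n\<close> is left after the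
      Markov bound divides the cost by \<open>\<delta> n\<close>.\<close>
    have "kr_norm (measure_diff \<mu> \<nu>) < \<delta> n * \<delta> n"
      using 0 mult_pos_pos[OF \<delta>[of n] \<delta>[of n]] by linarith
    then obtain \<pi> where \<pi>: "\<pi> \<in> couplings \<mu> \<nu>" "coupling_cost \<pi> < ennreal (\<delta> n * \<delta> n)"
      using kr_norm_ex_coupling[OF kr] by blast
    have "emeasure \<mu> C \<le> emeasure \<nu> (E n) + ennreal (1 / \<delta> n) * coupling_cost \<pi>"
      unfolding E_def by (rule emeasure_closed_le_of_coupling[OF \<pi>(1) C False \<delta>])
    also have "\<dots> \<le> emeasure \<nu> (E n) + ennreal (1 / \<delta> n) * ennreal (\<delta> n * \<delta> n)"
      using \<pi>(2) by (intro add_left_mono mult_left_mono) auto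
    also have "\<dots> = ennreal (measure \<nu> (E n) + \<delta> n)"
      using \<delta>[of n] by (simp add: \<nu>.emeasure_eq_measure less_imp_le flip: ennreal_mult)
    finally show ?thesis
      using \<delta>[of n] by (simp add: \<mu>.emeasure_eq_measure less_imp_le del: ennreal_plus)
  qed
  have "(\<lambda>n. measure \<nu> (E n)) \<longlonglongrightarrow> measure \<nu> (\<Inter>n. E n)"
  proof (rule \<nu>.finite_Lim_measure_decseq)
    show "range E \<subseteq> sets \<nu>"
      unfolding D(2) E_def by (auto intro!: borel_closed closed_Collect_le continuous_intros)
    show "decseq E"
    proof (rule decseq_SucI)
      fix n
      have "\<delta> (Suc n) \<le> \<delta> n"
        by (simp add: \<delta>_def field_simps)
      then show "E (Suc n) \<le> E n"
        by (auto simp: E_def)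
    qed
  qed
  also have "(\<Inter>n. E n) = C"
  proof (intro equalityI subsetI)
    fix y assume "y \<in> (\<Inter>n. E n)"
    then have "infdist y C \<le> \<delta> n" for n
      by (auto simp: E_def)
    then have "infdist y C \<le> 0"
      by (intro LIMSEQ_le_const[OF \<delta>lim]) auto
    then show "y \<in> C"
      using C False in_closed_iff_infdist_zero infdist_nonneg by (metis antisym)
  qed (use \<delta> in \<open>auto simp: E_def less_imp_le\<close>)
  finally have "(\<lambda>n. measure \<nu> (E n) + \<delta> n) \<longlonglongrightarrow> measure \<nu> C + 0"
    by (intro tendsto_add \<delta>lim)
  then show ?thesis
    using le by (intro LIMSEQ_le_const) auto
qed simp

text \<open>The closed-set inequality holds for the pair and, by negation, for the swapped pair.
  Closed sets are stable under intersection and generate the Borel sets, so the two finite measures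
  coincide.\<close>

lemma kr_norm_eq_0_imp:
  fixes m :: "'a::{metric_space, second_countable_topology} set \<Rightarrow> real"
  assumes "m \<in> KRM" "kr_norm m = 0"
  shows "m = (\<lambda>A. 0)"
proof -
  obtain \<mu> \<nu> where kr: "kr_pair \<mu> \<nu>" and m: "m = measure_diff \<mu> \<nu>"
    using assms by (auto simp: KRM_def)
  note D = kr_pairD[OF kr]
  have kr': "kr_pair \<nu> \<mu>"
    using kr kr_pair_commute by blast
  have "(\<lambda>A. - m A) = measure_diff \<nu> \<mu>"
    by (simp add: m measure_diff_def)
  then have "kr_norm (measure_diff \<nu> \<mu>) \<le> 0"
    using KRM_uminus(2)[OF assms(1)] assms(2) by simp
  then have "measure \<mu> C = measure \<nu> C" if "closed C" for C
    using measure_closed_le_of_kr_norm_eq_0[OF kr _ that] measure_closed_le_of_kr_norm_eq_0[OF kr' _ that]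
      assms(2) by (auto simp: m)
  then have "emeasure \<mu> C = emeasure \<nu> C" if "closed C" for C
    using that D by (simp add: finite_measure.emeasure_eq_measure)
  then have "\<mu> = \<nu>"
    using D by (intro measure_eqI_generator_eq[where E = "Collect closed" and \<Omega> = UNIV and A = "\<lambda>_. UNIV"])
      (auto simp: Int_stable_def borel_eq_closed finite_measure.emeasure_finite)
  then show ?thesis
    by (simp add: m measure_diff_def)
qed

section \<open>Finitely supported measures\<close>

text \<open>The sum of \<open>w i\<close> times the unit atom at \<open>X i\<close>. Indexing by
  \<open>I\<close> lets points coincide, as they may in a representation; the pushforward form makes
  images and integrals immediate. Through \<open>ennreal\<close> a negative weight counts as
  0.\<close>

definition weighted_points :: "'i set \<Rightarrow> ('i \<Rightarrow> real) \<Rightarrow> ('i \<Rightarrow> 'b) \<Rightarrow> 'b::topological_space measure" where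
  "weighted_points I w X = distr (point_measure I (\<lambda>i. ennreal (w i))) borel X"

lemma sets_weighted_points [simp, measurable_cong]: "sets (weighted_points I w X) = sets borel"
  by (simp add: weighted_points_def)

lemma nn_integral_weighted_points:
  assumes "finite I" "g \<in> borel_measurable borel"
  shows "(\<integral>\<^sup>+x. g x \<partial>weighted_points I w X) = (\<Sum>i\<in>I. ennreal (w i) * g (X i))"
  using assms by (simp add: weighted_points_def nn_integral_distr nn_integral_point_measure_finite)

lemma emeasure_weighted_points:
  assumes "finite I" "A \<in> sets borel"
  shows "emeasure (weighted_points I w X) A = (\<Sum>i\<in>I. ennreal (w i) * indicator A (X i))"
  using nn_integral_weighted_points[OF assms(1), of "indicator A" w X] assms(2) by simp

lemma measure_weighted_points:
  assumes "finite I" "A \<in> sets borel" "\<And>i. i \<in> I \<Longrightarrow> 0 \<le> w i"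
  shows "measure (weighted_points I w X) A = (\<Sum>i\<in>I. w i * indicator A (X i))"
proof -
  have "emeasure (weighted_points I w X) A = ennreal (\<Sum>i\<in>I. w i * indicator A (X i))"
  proof -
    have "(\<Sum>i\<in>I. ennreal (w i) * indicator A (X i)) = (\<Sum>i\<in>I. ennreal (w i * indicator A (X i)))"
      by (intro sum.cong refl) (simp split: split_indicator)
    also have "\<dots> = ennreal (\<Sum>i\<in>I. w i * indicator A (X i))"
      by (rule sum_ennreal) (simp add: assms(3))
    finally show ?thesis
      by (simp only: emeasure_weighted_points[OF assms(1,2)])
  qed
  then show ?thesis
    by (simp add: measure_def sum_nonneg assms(3))
qed

lemma finite_measure_weighted_points:
  assumes "finite I"
  shows "finite_measure (weighted_points I w X)"
proof (rule finite_measureI)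
  have "space (weighted_points I w X) = UNIV"
    by (simp add: weighted_points_def)
  then show "emeasure (weighted_points I w X) (space (weighted_points I w X)) \<noteq> \<infinity>"
    using assms by (simp add: emeasure_weighted_points)
qed

lemma finite_first_moment_weighted_points:
  fixes X :: "'i \<Rightarrow> 'a::{metric_space, second_countable_topology}"
  assumes "finite I"
  shows "finite_first_moment (weighted_points I w X)"
  unfolding finite_first_moment_def
  using assms by (intro exI[of _ undefined]) (simp add: nn_integral_weighted_points ennreal_mult_less_top)

lemma distr_weighted_points:
  assumes "finite I" "f \<in> borel_measurable borel"
  shows "distr (weighted_points I w X) borel f = weighted_points I w (\<lambda>i. f (X i))"
  using assms by (simp add: weighted_points_def distr_distr comp_def)

lemma eq_weighted_points:
  fixes \<pi> :: "'b::t1_space measure"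
  assumes s: "sets \<pi> = sets borel" and fin: "finite_measure \<pi>" and Z: "finite Z"
    and null: "emeasure \<pi> (- Z) = 0"
  shows "\<pi> = weighted_points Z (\<lambda>z. measure \<pi> {z}) (\<lambda>z. z)"
proof (rule measure_eqI)
  fix A assume A: "A \<in> sets \<pi>"
  have Zs: "B \<in> sets \<pi>" if "B \<subseteq> Z" for B
    using finite_subset[OF that Z] by (simp add: s borel_closed finite_imp_closed)
  have "emeasure \<pi> A = emeasure \<pi> (A \<inter> Z) + emeasure \<pi> (A - Z)"
    using A Zs by (subst plus_emeasure) (auto intro: arg_cong[where f = "emeasure \<pi>"])
  also have "emeasure \<pi> (A - Z) = 0"
  proof -
    have "emeasure \<pi> (A - Z) \<le> emeasure \<pi> (- Z)"
      using Zs[of Z] sets.compl_sets[of Z \<pi>] sets_eq_imp_space_eq[OF s]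
      by (intro emeasure_mono) (auto simp: Compl_eq_Diff_UNIV)
    then show ?thesis
      using null by simp
  qed
  also have "emeasure \<pi> (A \<inter> Z) = (\<Sum>z\<in>A \<inter> Z. emeasure \<pi> {z})"
    using Z Zs by (intro emeasure_eq_sum_singleton) auto
  also have "\<dots> = (\<Sum>z\<in>Z. ennreal (measure \<pi> {z}) * indicator A z)"
    using Z by (intro sum.mono_neutral_cong_left)
      (auto simp: finite_measure.emeasure_eq_measure[OF fin] indicator_def)
  finally show "emeasure \<pi> A = emeasure (weighted_points Z (\<lambda>z. measure \<pi> {z}) (\<lambda>z. z)) A"
    using A Z by (simp add: emeasure_weighted_points s)
qed (simp add: s)

text \<open>Summing over any finite superset of the support allows several functions to share one
  index set. The value 0 off the Borel sets matches the convention for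
  \<open>measure\<close>.\<close>

lemma tp_measure_eq_sum:
  assumes S: "finite S" "\<And>v. f v \<noteq> 0 \<Longrightarrow> v \<in> S"
  shows "tp_measure f A = (if A \<in> sets borel then \<Sum>v\<in>S. f v * indicator A v else 0)"
proof (cases "A \<in> sets borel")
  case True
  then have "tp_measure f A = (\<Sum>v | f v \<noteq> 0. f v * indicator A v)"
    by (simp add: tp_measure_def measure_return)
  also have "\<dots> = (\<Sum>v\<in>S. f v * indicator A v)"
    using S by (intro sum.mono_neutral_left) auto
  finally show ?thesis
    using True by simp
qed (simp add: tp_measure_def measure_notin_sets)

lemma TP_sum_eq_0:
  assumes "f \<in> TP" "finite S" "\<And>v. f v \<noteq> 0 \<Longrightarrow> v \<in> S"
  shows "(\<Sum>v\<in>S. f v) = 0"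
proof -
  have "(\<Sum>v\<in>S. f v) = (\<Sum>v | f v \<noteq> 0. f v)"
    using assms(2,3) by (intro sum.mono_neutral_right) auto
  then show ?thesis
    using assms(1) by (simp add: TP_def)
qed

lemma TP_finite_support: "f \<in> TP \<Longrightarrow> finite {v. f v \<noteq> 0}"
  by (simp add: TP_def)

lemma tp_measure_lincomb:
  assumes "f \<in> TP" "g \<in> TP"
  shows "tp_measure (\<lambda>v. a * f v + b * g v) = (\<lambda>A. a * tp_measure f A + b * tp_measure g A)"
proof
  fix A :: "'a set"
  let ?S = "{v. f v \<noteq> 0} \<union> {v. g v \<noteq> 0}"
  have "finite ?S"
    using assms TP_finite_support by auto
  note * = tp_measure_eq_sum[OF this]
  show "tp_measure (\<lambda>v. a * f v + b * g v) A = a * tp_measure f A + b * tp_measure g A"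
    by (subst (1 2 3) *) (auto simp: sum_distrib_left sum.distrib algebra_simps)
qed

lemma kr_pair_weighted_points:
  fixes X Y :: "_ \<Rightarrow> 'a::{metric_space, second_countable_topology}"
  assumes "finite I" "finite J" "\<And>i. i \<in> I \<Longrightarrow> 0 \<le> w i" "\<And>i. i \<in> J \<Longrightarrow> 0 \<le> w' i"
    and "(\<Sum>i\<in>I. w i) = (\<Sum>i\<in>J. w' i)"
  shows "kr_pair (weighted_points I w X) (weighted_points J w' Y)"
  using assms by (simp add: kr_pair_def finite_measure_weighted_points finite_first_moment_weighted_points
      emeasure_weighted_points)

lemma tp_measure_eq_measure_diff_parts:
  fixes f :: "'a::{metric_space, second_countable_topology} \<Rightarrow> real"
  assumes "f \<in> TP"
  defines "\<mu> \<equiv> weighted_points {v. f v \<noteq> 0} (\<lambda>v. max (f v) 0) (\<lambda>v. v)"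
    and "\<nu> \<equiv> weighted_points {v. f v \<noteq> 0} (\<lambda>v. max (- f v) 0) (\<lambda>v. v)"
  shows "tp_measure f = measure_diff \<mu> \<nu>" and "kr_pair \<mu> \<nu>"
proof -
  note fin = TP_finite_support[OF assms(1)]
  have parts: "max (f v) 0 - max (- f v) 0 = f v" for v
    by auto
  show "tp_measure f = measure_diff \<mu> \<nu>"
  proof
    fix A :: "'a set"
    show "tp_measure f A = measure_diff \<mu> \<nu> A"
    proof (cases "A \<in> sets borel")
      case True
      then have "measure_diff \<mu> \<nu> A = (\<Sum>v | f v \<noteq> 0. (max (f v) 0 - max (- f v) 0) * indicator A v)"
        using fin by (simp add: measure_diff_def \<mu>_def \<nu>_def measure_weighted_points sum_subtractf left_diff_distrib)
      with True fin show ?thesis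
        unfolding parts by (subst tp_measure_eq_sum[OF fin]) auto
    qed (simp add: tp_measure_eq_sum[OF fin] measure_diff_def measure_notin_sets \<mu>_def \<nu>_def)
  qed
  have "(\<Sum>v | f v \<noteq> 0. max (f v) 0) - (\<Sum>v | f v \<noteq> 0. max (- f v) 0) = 0"
    using TP_sum_eq_0[OF assms(1) fin] parts by (simp flip: sum_subtractf)
  then show "kr_pair \<mu> \<nu>"
    unfolding \<mu>_def \<nu>_def using fin by (intro kr_pair_weighted_points) auto
qed

lemma tp_measure_in_KRM:
  fixes f :: "'a::{metric_space, second_countable_topology} \<Rightarrow> real"
  assumes "f \<in> TP"
  shows "tp_measure f \<in> KRM"
  using tp_measure_eq_measure_diff_parts[OF assms] by (auto simp: KRM_def)

section \<open>Comparison with the transportation cost norm\<close>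

lemma tp_measure_eq_measure_diff_representation:
  fixes f :: "'a::{metric_space, second_countable_topology} \<Rightarrow> real"
  assumes f: "f \<in> TP" and rep: "tc_representation f n a x y"
  shows "tp_measure f = measure_diff (weighted_points {..<n} a x) (weighted_points {..<n} a y)"
proof
  fix A :: "'a set"
  have a: "0 \<le> a i" if "i \<in> {..<n}" for i
    using rep that by (auto simp: tc_representation_def)
  have f_eq: "f v = (\<Sum>i<n. a i * (indicator {x i} v - indicator {y i} v))" for v
    using rep by (simp add: tc_representation_def)
  define S where "S = {v. f v \<noteq> 0} \<union> x ` {..<n} \<union> y ` {..<n}"
  have S: "finite S" "\<And>v. f v \<noteq> 0 \<Longrightarrow> v \<in> S"
    using TP_finite_support[OF f] by (auto simp: S_def)
  have xyS: "x i \<in> S" "y i \<in> S" if "i < n" for i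
    using that by (auto simp: S_def)
  show "tp_measure f A = measure_diff (weighted_points {..<n} a x) (weighted_points {..<n} a y) A"
  proof (cases "A \<in> sets borel")
    case True
    have point: "(\<Sum>v\<in>S. indicator {z} v * indicator A v) = (indicator A z :: real)" if "z \<in> S" for z
      using S(1) that by (simp add: indicator_def if_distrib[of "\<lambda>t. t * _"] cong: if_cong)
    have "tp_measure f A = (\<Sum>v\<in>S. \<Sum>i<n. a i * (indicator {x i} v * indicator A v - indicator {y i} v * indicator A v))"
      using True by (subst tp_measure_eq_sum[OF S]) (simp_all add: f_eq sum_distrib_right left_diff_distrib right_diff_distrib mult.assoc)
    also have "\<dots> = (\<Sum>i<n. a i * ((\<Sum>v\<in>S. indicator {x i} v * indicator A v) - (\<Sum>v\<in>S. indicator {y i} v * indicator A v)))"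
      by (subst sum.swap) (simp only: sum_distrib_left sum_subtractf[symmetric])
    also have "\<dots> = (\<Sum>i<n. a i * (indicator A (x i) - indicator A (y i)))"
      by (intro sum.cong refl) (simp add: point xyS)
    also have "\<dots> = measure_diff (weighted_points {..<n} a x) (weighted_points {..<n} a y) A"
    proof -
      have "measure (weighted_points {..<n} a z) A = (\<Sum>i<n. a i * indicator A (z i))" for z
        using a True by (intro measure_weighted_points) auto
      then show ?thesis
        by (simp only: measure_diff_def sum_subtractf right_diff_distrib)
    qed
    finally show ?thesis .
  qed (simp add: tp_measure_eq_sum[OF S] measure_diff_def measure_notin_sets)
qed

text \<open>Atoms \<open>a i\<close> at \<open>(x i, y i)\<close> form a coupling whose cost is that
  of the representation. Its marginals may share mass, so they need not be the positive and negative
  parts of \<open>f\<close>; it is the independence of the cost from the pair that lets them compute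
  the norm.\<close>

lemma kr_norm_tp_measure_le:
  fixes f :: "'a::{metric_space, second_countable_topology} \<Rightarrow> real"
  assumes f: "f \<in> TP" and rep: "tc_representation f n a x y"
  shows "kr_norm (tp_measure f) \<le> (\<Sum>i<n. a i * dist (x i) (y i))"
proof -
  have a: "0 \<le> a i" if "i \<in> {..<n}" for i
    using rep that by (auto simp: tc_representation_def)
  let ?\<mu> = "weighted_points {..<n} a x" and ?\<nu> = "weighted_points {..<n} a y"
  let ?\<pi> = "weighted_points {..<n} a (\<lambda>i. (x i, y i))"
  have "kr_pair ?\<mu> ?\<nu>"
    using a by (intro kr_pair_weighted_points) auto
  moreover have "?\<pi> \<in> couplings ?\<mu> ?\<nu>"
    by (simp add: couplings_iff distr_weighted_points borel_measurable_fst_snd)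
  moreover have "coupling_cost ?\<pi> = (\<Sum>i<n. ennreal (a i) * ennreal (dist (x i) (y i)))"
    by (subst nn_integral_weighted_points) auto
  moreover have "\<dots> = ennreal (\<Sum>i<n. a i * dist (x i) (y i))"
    using a by (subst sum_ennreal[symmetric]) (auto simp: ennreal_mult)
  ultimately show ?thesis
    unfolding tp_measure_eq_measure_diff_representation[OF f rep]
    using a by (intro kr_norm_le_coupling_cost) (auto intro: sum_nonneg)
qed

lemma ex_tc_representation_less:
  fixes f :: "'a::{metric_space, second_countable_topology} \<Rightarrow> real"
  assumes f: "f \<in> TP" and c: "kr_norm (tp_measure f) < c"
  shows "\<exists>n a x y. tc_representation f n a x y \<and> (\<Sum>i<n. a i * dist (x i) (y i)) < c"
proof -
  define S where "S = {v. f v \<noteq> 0}"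
  have S: "finite S"
    using TP_finite_support[OF f] by (simp add: S_def)
  define \<mu> where "\<mu> = weighted_points S (\<lambda>v. max (f v) 0) (\<lambda>v. v)"
  define \<nu> where "\<nu> = weighted_points S (\<lambda>v. max (- f v) 0) (\<lambda>v. v)"
  have eq: "tp_measure f = measure_diff \<mu> \<nu>" and kr: "kr_pair \<mu> \<nu>"
    using tp_measure_eq_measure_diff_parts[OF f] by (simp_all add: \<mu>_def \<nu>_def S_def)
  obtain \<pi> where \<pi>: "\<pi> \<in> couplings \<mu> \<nu>" and cost: "coupling_cost \<pi> < ennreal c"
    using kr_norm_ex_coupling[OF kr] c by (auto simp: eq)
  have s: "sets \<pi> = sets borel" and d: "distr \<pi> borel fst = \<mu>" "distr \<pi> borel snd = \<nu>"
    using \<pi> couplings_iff[OF kr_pairD(1,2)[OF kr]] by blast+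
  define Z where "Z = S \<times> S"
  define w where "w z = measure \<pi> {z}" for z
  have Z: "finite Z"
    using S by (simp add: Z_def)
  have Sc: "- S \<in> sets borel"
    using S by (simp add: borel_open finite_imp_closed open_Compl)
  \<comment> \<open>Mass outside \<open>S \<times> S\<close> would show up in a marginal outside
    \<open>S\<close>. Hence \<open>\<pi>\<close> consists of finitely many atoms, and these become
    the terms of the representation.\<close>
  have null: "emeasure \<pi> (- Z) = 0"
  proof -
    have "emeasure \<mu> (- S) = 0" "emeasure \<nu> (- S) = 0"
      using S Sc by (simp_all add: \<mu>_def \<nu>_def emeasure_weighted_points)
    then have "emeasure \<pi> ((- S) \<times> UNIV) = 0" "emeasure \<pi> (UNIV \<times> (- S)) = 0"
      using \<pi> Sc by (auto simp: couplings_def)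
    moreover have "(- S) \<times> UNIV \<in> sets \<pi>" "UNIV \<times> (- S) \<in> sets \<pi>"
      using Sc by (auto simp: s simp flip: borel_prod)
    ultimately have "(- S) \<times> UNIV \<union> UNIV \<times> (- S) \<in> null_sets \<pi>"
      by (intro null_sets.Un) (auto simp: null_sets_def)
    moreover have "(- S) \<times> UNIV \<union> UNIV \<times> (- S) = - Z"
      by (auto simp: Z_def)
    ultimately show ?thesis
      by (auto simp: null_sets_def)
  qed
  have \<pi>_eq: "\<pi> = weighted_points Z w (\<lambda>z. z)"
    unfolding w_def
    by (rule eq_weighted_points[OF s finite_measure_coupling[OF kr_pairD(3,1)[OF kr] \<pi>] Z null])
  have \<mu>_eq: "\<mu> = weighted_points Z w fst" and \<nu>_eq: "\<nu> = weighted_points Z w snd"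
    using d Z by (simp_all add: \<pi>_eq distr_weighted_points borel_measurable_fst_snd)
  have w: "0 \<le> w z" for z
    by (simp add: w_def)
  \<comment> \<open>Both sides are the value of the signed measure on the singleton
    \<open>{v}\<close>, computed from \<open>f\<close> and from the marginals of
    \<open>\<pi>\<close>.\<close>
  have f_eq: "f v = (\<Sum>z\<in>Z. w z * (indicator {fst z} v - indicator {snd z} v))" for v
  proof -
    have [simp]: "{v} \<in> sets borel"
      by (simp add: borel_closed)
    have "tp_measure f {v} = (\<Sum>u\<in>S. f u * indicator {v} u)"
      by (subst tp_measure_eq_sum[OF S]) (simp_all add: S_def)
    also have "\<dots> = (\<Sum>u\<in>S. if u = v then f v else 0)"
      by (intro sum.cong refl) (simp split: split_indicator)
    also have "\<dots> = (if v \<in> S then f v else 0)"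
      using S by simp
    finally have "tp_measure f {v} = f v"
      by (auto simp: S_def)
    moreover have "tp_measure f {v} = (\<Sum>z\<in>Z. w z * (indicator {v} (fst z) - indicator {v} (snd z)))"
      unfolding eq measure_diff_def \<mu>_eq \<nu>_eq
      using Z w by (simp add: measure_weighted_points sum_subtractf right_diff_distrib)
    ultimately show ?thesis
      by (simp add: indicator_def eq_commute)
  qed
  obtain h where h: "bij_betw h {..<card Z} Z"
    using ex_bij_betw_nat_finite[OF Z] by (auto simp: atLeast0LessThan)
  have "tc_representation f (card Z) (\<lambda>i. w (h i)) (\<lambda>i. fst (h i)) (\<lambda>i. snd (h i))"
    unfolding tc_representation_def
    using w f_eq sum.reindex_bij_betw[OF h, of "\<lambda>z. w z * (indicator {fst z} _ - indicator {snd z} _)"]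
    by auto
  moreover have "(\<Sum>i<card Z. w (h i) * dist (fst (h i)) (snd (h i))) < c"
  proof -
    have "coupling_cost \<pi> = (\<Sum>z\<in>Z. ennreal (w z) * ennreal (dist (fst z) (snd z)))"
      unfolding \<pi>_eq using Z by (subst nn_integral_weighted_points) auto
    also have "\<dots> = ennreal (\<Sum>z\<in>Z. w z * dist (fst z) (snd z))"
      using w by (subst sum_ennreal[symmetric]) (auto simp: ennreal_mult)
    finally have "(\<Sum>z\<in>Z. w z * dist (fst z) (snd z)) < c"
      using cost w by (simp add: ennreal_less_iff sum_nonneg)
    then show ?thesis
      using sum.reindex_bij_betw[OF h, of "\<lambda>z. w z * dist (fst z) (snd z)"] by simp
  qed
  ultimately show ?thesis
    by blast
qed

lemma kr_norm_tp_measure: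
  fixes f :: "'a::{metric_space, second_countable_topology} \<Rightarrow> real"
  assumes f: "f \<in> TP"
  shows "kr_norm (tp_measure f) = tc_norm f"
proof (rule antisym)
  let ?C = "{\<Sum>i<n. a i * dist (x i) (y i) | n a x y. tc_representation f n a x y}"
  \<comment> \<open>The greatest-lower-bound rule for a real \<open>Inf\<close> requires a nonempty
    set; a coupling of cost below the norm plus 1 supplies a representation.\<close>
  have "?C \<noteq> {}"
    using ex_tc_representation_less[OF f, of "kr_norm (tp_measure f) + 1"] by auto
  then show "kr_norm (tp_measure f) \<le> tc_norm f"
    unfolding tc_norm_def using kr_norm_tp_measure_le[OF f] by (intro cInf_greatest) auto
  have bdd: "bdd_below ?C"
    by (rule bdd_belowI[of _ 0]) (auto simp: tc_representation_def intro!: sum_nonneg)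
  show "tc_norm f \<le> kr_norm (tp_measure f)"
  proof (rule dense_ge)
    fix c assume "kr_norm (tp_measure f) < c"
    then obtain n a x y where r: "tc_representation f n a x y" "(\<Sum>i<n. a i * dist (x i) (y i)) < c"
      using ex_tc_representation_less[OF f] by blast
    have "tc_norm f \<le> (\<Sum>i<n. a i * dist (x i) (y i))"
      unfolding tc_norm_def using r(1) by (intro cInf_lower bdd) auto
    with r(2) show "tc_norm f \<le> c"
      by simp
  qed
qed

section \<open>Density of the finitely supported measures\<close>

lemma kr_norm_distr_le:
  fixes \<mu> :: "'a::{metric_space, second_countable_topology} measure"
  assumes \<mu>: "sets \<mu> = sets borel" "finite_measure \<mu>" "finite_first_moment \<mu>"
    and T: "T \<in> borel_measurable borel" and c: "(\<integral>\<^sup>+x. ennreal (dist x (T x)) \<partial>\<mu>) \<le> ennreal c" "0 \<le> c"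
  shows "measure_diff \<mu> (distr \<mu> borel T) \<in> KRM"
    and "kr_norm (measure_diff \<mu> (distr \<mu> borel T)) \<le> c"
proof -
  note [measurable_cong] = \<mu>(1) and [measurable] = T
  interpret finite_measure \<mu> by fact
  have sp: "space \<mu> = UNIV"
    using sets_eq_imp_space_eq[OF \<mu>(1)] by simp
  \<comment> \<open>Integrability of the displacement \<open>dist x (T x)\<close> carries the finite
    first moment over to the image measure.\<close>
  have "finite_first_moment (distr \<mu> borel T)"
    unfolding finite_first_moment_def
  proof (intro exI)
    have "(\<integral>\<^sup>+x. ennreal (dist x undefined) \<partial>distr \<mu> borel T) = (\<integral>\<^sup>+x. ennreal (dist (T x) undefined) \<partial>\<mu>)"
      by (subst nn_integral_distr) auto
    also have "\<dots> \<le> (\<integral>\<^sup>+x. ennreal (dist x (T x)) + ennreal (dist x undefined) \<partial>\<mu>)"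
      by (intro nn_integral_mono) (simp add: dist_triangle3 flip: ennreal_plus)
    also have "\<dots> = (\<integral>\<^sup>+x. ennreal (dist x (T x)) \<partial>\<mu>) + (\<integral>\<^sup>+x. ennreal (dist x undefined) \<partial>\<mu>)"
      by (rule nn_integral_add) measurable
    also have "\<dots> < \<infinity>"
      using c(1) first_moment_finite[OF \<mu>, of undefined] by (auto simp: le_less_trans)
    finally show "(\<integral>\<^sup>+x. ennreal (dist x undefined) \<partial>distr \<mu> borel T) < \<infinity>" .
  qed
  then have kr: "kr_pair \<mu> (distr \<mu> borel T)"
    using \<mu> by (simp add: kr_pair_def finite_measure_distr emeasure_distr sp)
  then show "measure_diff \<mu> (distr \<mu> borel T) \<in> KRM"
    by (auto simp: KRM_def)
  have "distr \<mu> borel (\<lambda>x. (x, T x)) \<in> couplings \<mu> (distr \<mu> borel T)"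
    using distr_id2[of borel \<mu>] \<mu>(1) by (simp add: couplings_iff distr_distr comp_def borel_measurable_fst_snd)
  moreover have "coupling_cost (distr \<mu> borel (\<lambda>x. (x, T x))) = (\<integral>\<^sup>+x. ennreal (dist x (T x)) \<partial>\<mu>)"
    by (subst nn_integral_distr) auto
  ultimately show "kr_norm (measure_diff \<mu> (distr \<mu> borel T)) \<le> c"
    using c by (intro kr_norm_le_coupling_cost[OF kr]) auto
qed

text \<open>\<open>f\<close> assigns to a point the net mass of its fibre. Points outside the finite
  range have empty fibres, equal total masses make the sum 0, and summing over \<open>A\<close>
  collects the fibres into the preimage of \<open>A\<close>.\<close>

lemma measure_diff_distr_simple:
  fixes T :: "'a::{metric_space, second_countable_topology} \<Rightarrow> 'a"
  assumes kr: "kr_pair \<mu> \<nu>" and T: "T \<in> borel_measurable borel" "finite (range T)"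
  defines "f \<equiv> \<lambda>v. measure \<mu> (T -` {v}) - measure \<nu> (T -` {v})"
  shows "f \<in> TP" and "tp_measure f = measure_diff (distr \<mu> borel T) (distr \<nu> borel T)"
proof -
  note D = kr_pairD[OF kr]
  have supp: "v \<in> range T" if "f v \<noteq> 0" for v
  proof (rule ccontr)
    assume "v \<notin> range T"
    then have "T -` {v} = {}" by auto
    with that show False by (simp add: f_def)
  qed
  have sum: "(\<Sum>v\<in>range T. f v * indicator A v) = measure \<mu> (T -` A) - measure \<nu> (T -` A)"
    if A: "A \<in> sets borel" for A
  proof -
    have TA: "T -` A \<in> sets borel"
      using measurable_sets[OF T(1) A] by simp
    have "measure \<rho> (T -` {v}) * indicator A v = measure \<rho> (T -` A \<inter> T -` {v})" for \<rho> :: "'a measure" and v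
    proof (cases "v \<in> A")
      case True
      then have "T -` A \<inter> T -` {v} = T -` {v}" by auto
      with True show ?thesis by simp
    next
      case False
      then have "T -` A \<inter> T -` {v} = {}" by auto
      with False show ?thesis by simp
    qed
    then show ?thesis
      using sum_measure_Int_fibres[OF T D(3,1) TA] sum_measure_Int_fibres[OF T D(4,2) TA]
      by (simp add: f_def left_diff_distrib sum_subtractf)
  qed
  have "(\<Sum>v | f v \<noteq> 0. f v) = (\<Sum>v\<in>range T. f v)"
    using supp T(2) by (intro sum.mono_neutral_left) auto
  also have "\<dots> = 0"
    using sum[of UNIV] D(7) by (simp add: measure_def)
  finally show "f \<in> TP"
    using finite_subset[OF _ T(2), of "{v. f v \<noteq> 0}"] supp by (auto simp: TP_def)
  show "tp_measure f = measure_diff (distr \<mu> borel T) (distr \<nu> borel T)"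
  proof
    fix A :: "'a set"
    have m: "T \<in> measurable \<mu> borel" "T \<in> measurable \<nu> borel"
      using T(1) D(1,2) by (simp_all cong: measurable_cong_sets)
    show "tp_measure f A = measure_diff (distr \<mu> borel T) (distr \<nu> borel T) A"
      using m sets_eq_imp_space_eq[OF D(1)] sets_eq_imp_space_eq[OF D(2)]
      by (subst tp_measure_eq_sum[OF T(2) supp])
        (auto simp: sum measure_diff_def measure_distr measure_notin_sets)
  qed
qed

lemma TP_dense_in_KRM:
  fixes m :: "'a::{metric_space, second_countable_topology} set \<Rightarrow> real"
  assumes "m \<in> KRM" and \<epsilon>: "0 < \<epsilon>"
  shows "\<exists>f\<in>TP. kr_norm (\<lambda>A. m A - tp_measure f A) < \<epsilon>"
proof -
  obtain \<mu> \<nu> where kr: "kr_pair \<mu> \<nu>" and m: "m = measure_diff \<mu> \<nu>"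
    using assms by (auto simp: KRM_def)
  note D = kr_pairD[OF kr]
  obtain T :: "nat \<Rightarrow> 'a \<Rightarrow> 'a" where T: "\<And>n. T n \<in> borel_measurable borel" "\<And>n. finite (range (T n))"
    and lim: "\<And>\<rho>. sets \<rho> = sets borel \<Longrightarrow> finite_measure \<rho> \<Longrightarrow> finite_first_moment \<rho> \<Longrightarrow>
       (\<lambda>n. \<integral>\<^sup>+x. ennreal (dist x (T n x)) \<partial>\<rho>) \<longlonglongrightarrow> 0"
    using ex_simple_retraction_sequence[where 'a='a] by blast
  \<comment> \<open>Each of the two image measures contributes at most \<open>c\<close>, and two
    thirds of \<open>\<epsilon>\<close> is strictly below \<open>\<epsilon>\<close>.\<close>
  define c where "c = \<epsilon> / 3"
  have c: "0 < c" "0 < ennreal c"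
    using \<epsilon> by (simp_all add: c_def)
  have "\<forall>\<^sub>F n in sequentially. (\<integral>\<^sup>+x. ennreal (dist x (T n x)) \<partial>\<mu>) < ennreal c \<and>
      (\<integral>\<^sup>+x. ennreal (dist x (T n x)) \<partial>\<nu>) < ennreal c"
    by (intro eventually_conj order_tendstoD(2)[OF lim] D c)
  from eventually_happens'[OF sequentially_bot this]
  obtain n where n: "(\<integral>\<^sup>+x. ennreal (dist x (T n x)) \<partial>\<mu>) \<le> ennreal c"
      "(\<integral>\<^sup>+x. ennreal (dist x (T n x)) \<partial>\<nu>) \<le> ennreal c"
    by (auto dest: less_imp_le)
  define f where "f v = measure \<mu> (T n -` {v}) - measure \<nu> (T n -` {v})" for v
  note f = measure_diff_distr_simple[OF kr T(1)[of n] T(2)[of n], folded f_def]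
  \<comment> \<open>\<open>m - tp_measure f\<close> is the displacement of \<open>\<mu>\<close>
    minus that of \<open>\<nu>\<close>, both under the same \<open>T n\<close>.\<close>
  let ?m1 = "measure_diff \<mu> (distr \<mu> borel (T n))" and ?m2 = "measure_diff \<nu> (distr \<nu> borel (T n))"
  have "kr_norm (\<lambda>A. 1 * ?m1 A + (- 1) * ?m2 A) \<le> \<bar>1\<bar> * kr_norm ?m1 + \<bar>- 1\<bar> * kr_norm ?m2"
    using n c D T(1) by (intro KRM_lincomb(2) kr_norm_distr_le(1)) auto
  also have "\<dots> \<le> c + c"
    using kr_norm_distr_le(2)[OF D(1,3,5) T(1) n(1)] kr_norm_distr_le(2)[OF D(2,4,6) T(1) n(2)] c by simp
  also have "\<dots> < \<epsilon>"
    using \<epsilon> by (simp add: c_def)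
  also have "(\<lambda>A. 1 * ?m1 A + (- 1) * ?m2 A) = (\<lambda>A. m A - tp_measure f A)"
    by (simp add: f(2) m measure_diff_def fun_eq_iff)
  finally show ?thesis
    using f(1) by blast
qed

section \<open>Extension to the completion\<close>

text \<open>The bound on \<open>N\<close> with real scalars contains both the triangle inequality
  and invariance under sign, which make \<open>D\<close> behave as a distance; \<open>N0\<close>
  becomes injectivity of \<open>J\<close>.\<close>

lemma is_completion_extend_dense:
  fixes \<iota> :: "('c \<Rightarrow> real) \<Rightarrow> 'b::banach" and e :: "('c \<Rightarrow> real) \<Rightarrow> ('d \<Rightarrow> real)"
  assumes comp: "is_completion U N\<^sub>U \<iota> X"
    and V: "\<And>m m' a b. m \<in> V \<Longrightarrow> m' \<in> V \<Longrightarrow> (\<lambda>t. a * m t + b * m' t) \<in> V"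
    and N: "\<And>m m' a b. m \<in> V \<Longrightarrow> m' \<in> V \<Longrightarrow> N (\<lambda>t. a * m t + b * m' t) \<le> \<bar>a\<bar> * N m + \<bar>b\<bar> * N m'"
    and N0: "\<And>m. m \<in> V \<Longrightarrow> N m = 0 \<Longrightarrow> m = (\<lambda>t. 0)"
    and eV: "\<And>f. f \<in> U \<Longrightarrow> e f \<in> V"
    and e_lin: "\<And>f g a b. f \<in> U \<Longrightarrow> g \<in> U \<Longrightarrow> e (\<lambda>t. a * f t + b * g t) = (\<lambda>t. a * e f t + b * e g t)"
    and Ne: "\<And>f. f \<in> U \<Longrightarrow> N (e f) = N\<^sub>U f"
    and dense: "\<And>m \<epsilon>. m \<in> V \<Longrightarrow> 0 < \<epsilon> \<Longrightarrow> \<exists>f\<in>U. N (\<lambda>t. m t - e f t) < \<epsilon>"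
  shows "\<exists>J. is_completion V N J X \<and> (\<forall>f\<in>U. J (e f) = \<iota> f)"
proof -
  define D where "D m m' = N (\<lambda>t. m t - m' t)" for m m'
  have U: "(\<lambda>t. a * f t + b * g t) \<in> U" if "f \<in> U" "g \<in> U" for f g a b
    using comp that by (simp add: is_completion_def)
  have \<iota>_lin: "\<iota> (\<lambda>t. a * f t + b * g t) = a *\<^sub>R \<iota> f + b *\<^sub>R \<iota> g" if "f \<in> U" "g \<in> U" for f g a b
    using comp that by (simp add: is_completion_def)
  have \<iota>_norm: "norm (\<iota> f) = N\<^sub>U f" if "f \<in> U" for f
    using comp that by (simp add: is_completion_def)
  have Vdiff: "(\<lambda>t. m t - m' t) \<in> V" if "m \<in> V" "m' \<in> V" for m m'
    using V[OF that, of 1 "-1"] by simp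
  have N_minus_le: "N (\<lambda>t. - m t) \<le> N m" if "m \<in> V" for m
    using N[OF that that, of "-1" 0] by simp
  have N_minus: "N (\<lambda>t. - m t) = N m" if "m \<in> V" for m
    using N_minus_le[OF that] N_minus_le[of "\<lambda>t. - m t"] V[OF that that, of "-1" 0] by simp
  have D_sym: "D m m' = D m' m" if "m \<in> V" "m' \<in> V" for m m'
    using N_minus[OF Vdiff[OF that]] by (simp add: D_def)
  have D_tri: "D m k \<le> D m m' + D m' k" if "m \<in> V" "m' \<in> V" "k \<in> V" for m m' k
    using N[OF Vdiff[OF that(1,2)] Vdiff[OF that(2,3)], of 1 1] by (simp add: D_def)
  have isometry: "norm (\<iota> f - \<iota> g) = D (e f) (e g)" if "f \<in> U" "g \<in> U" for f g
    using \<iota>_norm[OF U[OF that, of 1 "-1"]] \<iota>_lin[OF that, of 1 "-1"]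
      Ne[OF U[OF that, of 1 "-1"]] e_lin[OF that, of 1 "-1"] by (simp add: D_def)
  \<comment> \<open>\<open>U\<close> is seen to be nonempty only through density, which needs some
    \<open>m\<close> in \<open>V\<close> to approximate.\<close>
  have zero: "(\<lambda>t. 0) \<in> U \<and> \<iota> (\<lambda>t. 0) = 0 \<and> e (\<lambda>t. 0) = (\<lambda>t. 0)" if m: "m \<in> V" for m
  proof -
    obtain f where f: "f \<in> U"
      using dense[OF m, of 1] by auto
    show ?thesis
      using U[OF f f, of 0 0] \<iota>_lin[OF f f, of 0 0] e_lin[OF f f, of 0 0] by simp
  qed
  \<comment> \<open>\<open>l\<close> is the limit of the images of approximants of \<open>m\<close>,
    but it is recorded by its distances to all \<open>\<iota> f\<close>. This description does not
    mention the chosen sequence, and every property of \<open>J\<close> is derived from it.\<close>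
  have "\<exists>l. \<forall>f\<in>U. norm (\<iota> f - l) = D (e f) m" if m: "m \<in> V" for m
  proof -
    have "\<forall>n. \<exists>f\<in>U. D m (e f) < inverse (real (Suc n))"
      using dense[OF m] by (simp add: D_def)
    then obtain g where g: "\<And>n. g n \<in> U" "\<And>n. D m (e (g n)) < inverse (real (Suc n))"
      by metis
    have lim0: "(\<lambda>n. inverse (real (Suc n))) \<longlonglongrightarrow> 0"
      by (rule LIMSEQ_inverse_real_of_nat)
    have "Cauchy (\<lambda>n. \<iota> (g n))"
    proof (rule metric_CauchyI)
      fix r :: real assume "0 < r"
      then obtain M where M: "\<And>n. n \<ge> M \<Longrightarrow> inverse (real (Suc n)) < r / 2"
        using order_tendstoD(2)[OF lim0, of "r/2"] by (auto simp: eventually_sequentially)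
      have "dist (\<iota> (g i)) (\<iota> (g j)) < r" if "i \<ge> M" "j \<ge> M" for i j
      proof -
        have "dist (\<iota> (g i)) (\<iota> (g j)) \<le> D m (e (g i)) + D m (e (g j))"
          using D_tri[OF eV[OF g(1)] m eV[OF g(1)], of i j] D_sym[OF m eV[OF g(1)], of i]
          by (simp add: dist_norm isometry g(1))
        then show ?thesis
          using g(2)[of i] g(2)[of j] M[OF that(1)] M[OF that(2)] by linarith
      qed
      then show "\<exists>M. \<forall>i\<ge>M. \<forall>j\<ge>M. dist (\<iota> (g i)) (\<iota> (g j)) < r"
        by blast
    qed
    then obtain l where l: "(\<lambda>n. \<iota> (g n)) \<longlonglongrightarrow> l"
      using Cauchy_convergent convergent_def by blast
    have "norm (\<iota> f - l) = D (e f) m" if f: "f \<in> U" for f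
    proof (rule LIMSEQ_unique)
      show "(\<lambda>n. norm (\<iota> f - \<iota> (g n))) \<longlonglongrightarrow> norm (\<iota> f - l)"
        by (intro tendsto_norm tendsto_diff tendsto_const l)
      have "\<bar>D (e f) (e (g n)) - D (e f) m\<bar> \<le> inverse (real (Suc n))" for n
        using D_tri[OF eV[OF f] m eV[OF g(1)], of n] D_tri[OF eV[OF f] eV[OF g(1)] m, of n]
          D_sym[OF m eV[OF g(1)], of n] g(2)[of n] by linarith
      then have "(\<lambda>n. D (e f) (e (g n)) - D (e f) m) \<longlonglongrightarrow> 0"
        by (intro Lim_null_comparison[OF _ lim0]) simp
      then show "(\<lambda>n. norm (\<iota> f - \<iota> (g n))) \<longlonglongrightarrow> D (e f) m"
        by (simp add: isometry[OF f g(1)] LIM_zero_iff)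
    qed
    then show ?thesis by blast
  qed
  then obtain J where J: "\<And>m f. m \<in> V \<Longrightarrow> f \<in> U \<Longrightarrow> norm (\<iota> f - J m) = D (e f) m"
    by metis
  have J_lin: "J (\<lambda>t. a * m t + b * m' t) = a *\<^sub>R J m + b *\<^sub>R J m'" if m: "m \<in> V" "m' \<in> V" for m m' a b
  proof -
    let ?k = "\<lambda>t. a * m t + b * m' t"
    \<comment> \<open>The factor 2 comes from comparing both sides with \<open>\<iota> ?h\<close>;
      the summand 1 keeps \<open>C\<close> positive when \<open>a = b = 0\<close>.\<close>
    define C where "C = 2 * (\<bar>a\<bar> + \<bar>b\<bar>) + 1"
    have C: "0 < C" by (simp add: C_def)
    have "norm (J ?k - (a *\<^sub>R J m + b *\<^sub>R J m')) \<le> 0 + r" if "0 < r" for r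
    proof -
      define \<delta> where "\<delta> = r / C"
      have \<delta>: "0 < \<delta>" using that C by (simp add: \<delta>_def)
      obtain f where f: "f \<in> U" "D m (e f) < \<delta>"
        using dense[OF m(1) \<delta>] by (auto simp: D_def)
      obtain g where g: "g \<in> U" "D m' (e g) < \<delta>"
        using dense[OF m(2) \<delta>] by (auto simp: D_def)
      let ?h = "\<lambda>t. a * f t + b * g t"
      have "norm (\<iota> ?h - J ?k) = N (\<lambda>t. a * (e f t - m t) + b * (e g t - m' t))"
        using J[OF V[OF m] U[OF f(1) g(1)]] by (simp add: D_def e_lin f g algebra_simps)
      also have "\<dots> \<le> \<bar>a\<bar> * D (e f) m + \<bar>b\<bar> * D (e g) m'"
        unfolding D_def by (intro N Vdiff eV f g m)
      finally have 1: "norm (\<iota> ?h - J ?k) \<le> \<bar>a\<bar> * D (e f) m + \<bar>b\<bar> * D (e g) m'" .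
      have "\<iota> ?h - (a *\<^sub>R J m + b *\<^sub>R J m') = a *\<^sub>R (\<iota> f - J m) + b *\<^sub>R (\<iota> g - J m')"
        by (simp add: \<iota>_lin f g algebra_simps)
      then have 2: "norm (\<iota> ?h - (a *\<^sub>R J m + b *\<^sub>R J m')) \<le> \<bar>a\<bar> * D (e f) m + \<bar>b\<bar> * D (e g) m'"
        using norm_triangle_ineq[of "a *\<^sub>R (\<iota> f - J m)" "b *\<^sub>R (\<iota> g - J m')"] by (simp add: J f g m)
      have "norm (J ?k - (a *\<^sub>R J m + b *\<^sub>R J m')) \<le> 2 * (\<bar>a\<bar> * D (e f) m + \<bar>b\<bar> * D (e g) m')"
        using add_mono[OF 1 2] dist_triangle3[of "J ?k" "a *\<^sub>R J m + b *\<^sub>R J m'" "\<iota> ?h"]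
        unfolding dist_norm mult_2 by (rule order_trans[rotated])
      also have "\<dots> \<le> 2 * (\<bar>a\<bar> * \<delta> + \<bar>b\<bar> * \<delta>)"
        using f g D_sym m eV by (intro mult_left_mono add_mono) (auto simp: less_imp_le)
      also have "\<dots> = (C - 1) * \<delta>"
        by (simp add: C_def algebra_simps)
      also have "\<dots> \<le> C * \<delta>"
        using \<delta> by (intro mult_right_mono) auto
      also have "\<dots> = r"
        using C by (simp add: \<delta>_def)
      finally show ?thesis by simp
    qed
    then have "norm (J ?k - (a *\<^sub>R J m + b *\<^sub>R J m')) \<le> 0"
      by (rule field_le_epsilon)
    then show ?thesis by simp
  qed
  have J_norm: "norm (J m) = N m" if m: "m \<in> V" for m
    using J[OF m, of "\<lambda>t. 0"] zero[OF m] N_minus[OF m] by (simp add: D_def)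
  have J_e: "J (e f) = \<iota> f" if f: "f \<in> U" for f
    using J[OF eV[OF f] f] isometry[OF f f] by (simp add: D_def)
  have "inj_on J V"
  proof (rule inj_onI)
    fix m m' assume m: "m \<in> V" "m' \<in> V" and eq: "J m = J m'"
    then have "N (\<lambda>t. m t - m' t) = 0"
      using J_norm[OF Vdiff[OF m]] J_lin[OF m, of 1 "-1"] by simp
    then show "m = m'"
      using N0[OF Vdiff[OF m]] by (simp add: fun_eq_iff)
  qed
  moreover have "closure (J ` V) = X"
  proof -
    have "\<iota> ` U \<subseteq> J ` V"
      using eV J_e by (force simp: image_iff)
    moreover have "J ` V \<subseteq> closure (\<iota> ` U)"
    proof (clarsimp simp: closure_approachable)
      fix m and r :: real assume m: "m \<in> V" and "0 < r"
      then obtain f where "f \<in> U" "D m (e f) < r"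
        using dense by (auto simp: D_def)
      then show "\<exists>f\<in>U. dist (\<iota> f) (J m) < r"
        using J[OF m] D_sym[OF m eV] by (auto simp: dist_norm)
    qed
    ultimately have "closure (J ` V) = closure (\<iota> ` U)"
      by (meson closed_closure closure_minimal closure_mono subset_antisym)
    then show ?thesis
      using comp by (simp add: is_completion_def)
  qed
  ultimately have "is_completion V N J X"
    using V J_lin J_norm by (simp add: is_completion_def)
  then show ?thesis
    using J_e by blast
qed

text \<open>"Regarded as" is made precise by letting \<open>TC\<close> be an arbitrary realisation
  of the completion and asking for an embedding of \<open>KRM\<close> compatible with
  \<open>\<iota>\<close>. The completion clause for \<open>KRM\<close> also contains that
  \<open>KRM\<close> is a vector space on which \<open>kr_norm\<close> is a norm.\<close>

theorem theorem1p13: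
  fixes \<iota> :: "('a::polish_space \<Rightarrow> real) \<Rightarrow> 'b::banach"
    and TC :: "'b set"
  shows
    "(\<forall>f\<in>(TP :: ('a \<Rightarrow> real) set). tp_measure f \<in> KRM \<and> kr_norm (tp_measure f) = tc_norm f) \<and>
     (\<forall>m\<in>(KRM :: ('a set \<Rightarrow> real) set). \<forall>\<epsilon>>0. \<exists>f\<in>TP.
        kr_norm (\<lambda>A. m A - tp_measure f A) < \<epsilon>) \<and>
     (is_completion TP tc_norm \<iota> TC \<longrightarrow>
        (\<exists>J. is_completion KRM kr_norm J TC \<and> (\<forall>f\<in>TP. J (tp_measure f) = \<iota> f)))"
proof (intro conjI ballI allI impI)
  fix f :: "'a \<Rightarrow> real" assume "f \<in> TP"
  then show "tp_measure f \<in> KRM" "kr_norm (tp_measure f) = tc_norm f"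
    by (rule tp_measure_in_KRM, rule kr_norm_tp_measure)
next
  fix m :: "'a set \<Rightarrow> real" and \<epsilon> :: real assume "m \<in> KRM" "0 < \<epsilon>"
  then show "\<exists>f\<in>TP. kr_norm (\<lambda>A. m A - tp_measure f A) < \<epsilon>"
    by (rule TP_dense_in_KRM)
next
  assume "is_completion TP tc_norm \<iota> TC"
  then show "\<exists>J. is_completion KRM kr_norm J TC \<and> (\<forall>f\<in>TP. J (tp_measure f) = \<iota> f)"
    by (rule is_completion_extend_dense)
      (fact KRM_lincomb kr_norm_eq_0_imp tp_measure_in_KRM tp_measure_lincomb kr_norm_tp_measure TP_dense_in_KRM)+
qed

end
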